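(* Let $J_0$ be a Jacobi matrix on a finite connected graph $\mathcal G_0$ with $p$ vertices and without vertices of degree $1$, let $\ell$ be the first Betti number of $\mathcal G_0$, $d=2\ell$, and fix a choice of edges $e_1,\dots,e_\ell$ of $\mathcal G_0$ whose removal turns $\mathcal G_0$ into a tree, with associated $p\times p$ matrices $B$, $A_1,\dots,A_\ell$ and $A=\sum_{i=1}^\ell(A_i+A_i^* )$. Let $J$ be the lift of $J_0$ to a finite cover of $\mathcal G_0$, viewed as acting on $L^2(G,\mathbb C^p)$, where $G$ is the finite $d$-regular skeleton graph of the cover, by $$(Jx)_u=Bx_u+\sum_{i=1}^{\ell}\left(A_i x_{u+e_i}+A_i^*x_{u-e_i}\right).$$ Let $r\geq 1$ be an integer, and suppose that there exist a fixed $j\in\{1,\dots,\ell\}$ and a pair of edges $\epsilon_1,\epsilon_2\in E(G)$, each weighted by either $A_j$ or $A_j^*$, such that the distance in $G$ between the ends of $\epsilon_1$ and the ends of $\epsilon_2$ is greater than $2r+2$. Then for every unit vector $y\in\mathbb C^p$ with non-negative entries, $$\lambda_2(J)\ \ge\ \langle By,y\rangle+2\sqrt{d-1}\,\frac{\langle Ay,y\rangle}{d}-\frac{C_j}{r},$$ where $$C_j=(2\sqrt{d-1}-1)\frac{\langle Ay,y\rangle}{d}+\left|\frac{\langle Ay,y\rangle}{d}-\langle A_jy,y\rangle\right|.$$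
   Context: Graphs are undirected; multiple edges and loops are allowed; vertices of degree $1$ are not allowed (a loop contributes $2$ to the degree). A Jacobi matrix on a graph with vertex set $V$ and edge set $E$ is given by positive numbers $\{a_e\}_{e\in E}$ and real numbers $\{b_v\}_{v\in V}$, and is the operator on $L^2(V)$ with matrix entries $J_{v,v}=b_v+2\sum_{e\text{ a loop at }v}a_e$; $J_{v,w}=\sum_{e\text{ between }v\text{ and }w}a_e$ (sum over all edges joining $v$ and $w$) if $v\ne w$ are neighbors; and $J_{v,w}=0$ if $v\neq w$ are not neighbors. If $\pi:\mathcal G\to\mathcal G_0$ is a graph covering, the lift of $J_0$ (with parameters $\{a_e,b_v\}$) to $\mathcal G$ is the Jacobi matrix with parameters $a_{\tilde e}=a_{\pi(\tilde e)}$, $b_{\tilde v}=b_{\pi(\tilde v)}$. $\lambda_1(J)\ge\lambda_2(J)\ge\cdots$ are the eigenvalues counted with multiplicity. Block ("lego block") description. Let $\ell$ be the first Betti number (number of independent closed paths) of $\mathcal G_0$, $d=2\ell$, and choose edges $e_1,\dots,e_\ell$ whose removal turns $\mathcal G_0$ into a tree (the choice is not unique). Let $B$ be the $p\times p$ matrix which is the restriction of $J_0$ to this tree (diagonal entries $b_v$, off-diagonal entries from the remaining edges). Choose a direction for each $e_i$ and let $A_i$ be the $p\times p$ matrix with $(A_i)_{vw}=a_{e_i}$ if $v$ is the initial vertex and $w$ the terminal vertex of $e_i$, all other entries $0$ (if $e_i$ is a loop at $v$, then $A_i=A_i^*$ has $a_{e_i}$ at the diagonal entry of $v$). Then $J_0=B+\sum_{i=1}^\ell(A_i+A_i^*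 )=B+A$. Any cover of $\mathcal G_0$ is obtained by placing a copy of the block (the tree above together with the $2\ell$ half-edges $e_i^{\pm}$ obtained by cutting each $e_i$ in half) at each vertex of a $d$-regular graph $G$ (the skeleton; loops and multiple edges allowed) and gluing, along each edge of $G$, a half-edge $e_i^+$ of one block to a half-edge $e_i^-$ of another (or the same) block, for the same $i$. Thus for each $i$ there is a permutation $u\mapsto u+e_i$ of $V(G)$ with inverse $u\mapsto u-e_i$, the edges of $G$ are the pairs $(u,u+e_i)$, and $\{u\pm e_i\}_{i=1}^\ell$ are the $d$ neighbors of $u$. The edge between $u$ and $u+e_i$ is said to be weighted by $A_i$ (or by $A_i^*$, when traversed in the opposite direction). $L^2(G,\mathbb C^p)$ is the space of $\mathbb C^p$-valued functions $x=(x_u)_{u\in V(G)}$, the component in $\mathbb C^p$ of $x_u$ giving the values on the block at $u$. *)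

theory Defs
  imports "HOL-Analysis.Analysis" "HOL-Library.Uprod" "HOL-Library.Extended_Nat" "HOL-Library.Multiset"
begin

section \<open>Graphs with loops and multiple edges\<close>

text \<open>
  A finite undirected graph is a map \<open>ends :: 'e \<Rightarrow> 'v uprod\<close> from a finite type of edges to
  unordered pairs of vertices; \<open>Upair v v\<close> is a loop and non-injectivity gives multiple edges.
  A set \<open>F\<close> of edges stands for the spanning subgraph with edge set \<open>F\<close>.
\<close>

text \<open>Number of times the edge \<open>p\<close> meets the vertex \<open>v\<close>; a loop at \<open>v\<close> counts twice.\<close>

definition incidence :: "'v uprod \<Rightarrow> 'v \<Rightarrow> nat" where
  "incidence p v = (if p = Upair v v then 2 else if v \<in> set_uprod p then 1 else 0)"

definition vertex_degree :: "('e::finite \<Rightarrow> 'v uprod) \<Rightarrow> 'v \<Rightarrow> nat" where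
  "vertex_degree ends v = (\<Sum>e\<in>UNIV. incidence (ends e) v)"

inductive walk :: "'e set \<Rightarrow> ('e \<Rightarrow> 'v uprod) \<Rightarrow> 'v \<Rightarrow> 'e list \<Rightarrow> 'v \<Rightarrow> bool"
  for F :: "'e set" and ends :: "'e \<Rightarrow> 'v uprod" where
  Nil: "walk F ends v [] v"
| Cons: "e \<in> F \<Longrightarrow> ends e = Upair u v \<Longrightarrow> walk F ends v es w \<Longrightarrow> walk F ends u (e # es) w"

definition connected_graph :: "'e set \<Rightarrow> ('e \<Rightarrow> 'v uprod) \<Rightarrow> bool" where
  "connected_graph F ends \<longleftrightarrow> (\<forall>u v. \<exists>es. walk F ends u es v)"

text \<open>No nontrivial closed walk is free of repeated edges; this excludes loops and double edges.\<close>

definition acyclic_graph :: "'e set \<Rightarrow> ('e \<Rightarrow> 'v uprod) \<Rightarrow> bool" where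
  "acyclic_graph F ends \<longleftrightarrow> \<not> (\<exists>u es. walk F ends u es u \<and> es \<noteq> [] \<and> distinct es)"

definition tree_graph :: "'e set \<Rightarrow> ('e \<Rightarrow> 'v uprod) \<Rightarrow> bool" where
  "tree_graph F ends \<longleftrightarrow> connected_graph F ends \<and> acyclic_graph F ends"

definition components :: "('e \<Rightarrow> 'v uprod) \<Rightarrow> 'v set set" where
  "components ends = UNIV // {(u, v). \<exists>es. walk UNIV ends u es v}"

text \<open>First Betti number; the truncated subtraction is harmless as \<open>|E| + c \<ge> |V|\<close> always.\<close>

definition betti :: "('e::finite \<Rightarrow> 'v::finite uprod) \<Rightarrow> nat" where
  "betti ends = card (UNIV :: 'e set) + card (components ends) - card (UNIV :: 'v set)"

text \<open>The value is \<open>\<infinity>\<close> when there is no walk (\<open>Inf {} = \<infinity>\<close>).\<close>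

definition graph_dist :: "'e set \<Rightarrow> ('e \<Rightarrow> 'v uprod) \<Rightarrow> 'v \<Rightarrow> 'v \<Rightarrow> enat" where
  "graph_dist F ends u v = (INF es\<in>{es. walk F ends u es v}. enat (length es))"

text \<open>
  The maps \<open>\<pi>V\<close>, \<open>\<pi>E\<close> form a graph covering: they preserve incidence and the edges at a vertex
  \<open>x\<close> are in bijection, through \<open>\<pi>E\<close>, with those at \<open>\<pi>V x\<close>, where a loop is counted as two
  half-edges (so a loop is covered by disjoint cycles, possibly of length 1 or 2).
\<close>

definition graph_covering ::
  "('y::finite \<Rightarrow> 'x uprod) \<Rightarrow> ('x \<Rightarrow> 'v) \<Rightarrow> ('y \<Rightarrow> 'e) \<Rightarrow> ('e \<Rightarrow> 'v uprod) \<Rightarrow> bool" where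
  "graph_covering ends \<pi>V \<pi>E ends\<^sub>0 \<longleftrightarrow>
     surj \<pi>V \<and>
     (\<forall>y. map_uprod \<pi>V (ends y) = ends\<^sub>0 (\<pi>E y)) \<and>
     (\<forall>x e. (\<Sum>y | \<pi>E y = e. incidence (ends y) x) = incidence (ends\<^sub>0 e) (\<pi>V x))"

section \<open>Jacobi matrices and blocks\<close>

definition jacobi_on ::
  "'e set \<Rightarrow> ('e::finite \<Rightarrow> 'v::finite uprod) \<Rightarrow> ('e \<Rightarrow> real) \<Rightarrow> ('v \<Rightarrow> real) \<Rightarrow> complex^'v^'v" where
  "jacobi_on F ends a b = (\<chi> v w. of_real
     (if v = w then b v + 2 * (\<Sum>e | e \<in> F \<and> ends e = Upair v v. a e)
      else (\<Sum>e | e \<in> F \<and> ends e = Upair v w. a e)))"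

abbreviation jacobi ::
  "('e::finite \<Rightarrow> 'v::finite uprod) \<Rightarrow> ('e \<Rightarrow> real) \<Rightarrow> ('v \<Rightarrow> real) \<Rightarrow> complex^'v^'v" where
  "jacobi \<equiv> jacobi_on UNIV"

definition elementary_matrix :: "'v \<Rightarrow> 'v \<Rightarrow> real \<Rightarrow> complex^'v^'v" where
  "elementary_matrix s t c = (\<chi> v w. if v = s \<and> w = t then of_real c else 0)"

definition ctranspose :: "complex^'n^'n \<Rightarrow> complex^'n^'n" where
  "ctranspose M = (\<chi> v w. cnj (M $ w $ v))"

definition cinner :: "complex^'n \<Rightarrow> complex^'n \<Rightarrow> complex" where
  "cinner x y = (\<Sum>v\<in>UNIV. x $ v * cnj (y $ v))"

section \<open>Eigenvalues\<close>

definition eigenspace :: "complex^'n^'n \<Rightarrow> complex \<Rightarrow> (complex^'n) set" where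
  "eigenspace M s = {x. M *v x = s *s x}"

text \<open>
  The real eigenvalues in decreasing order, each repeated according to the complex dimension of
  its eigenspace. For a Hermitian matrix these are all eigenvalues.
\<close>

definition eigenvalue_list :: "complex^'n^'n \<Rightarrow> real list" where
  "eigenvalue_list M = rev (sorted_list_of_multiset
     (\<Sum>s\<in>{s. eigenspace M (of_real s) \<noteq> {0}}.
        replicate_mset (vec.dim (eigenspace M (of_real s))) s))"

definition eigval :: "nat \<Rightarrow> complex^'n^'n \<Rightarrow> real" where
  "eigval k M = eigenvalue_list M ! (k - 1)"

section \<open>Skeletons\<close>

text \<open>
  Edges \<open>ed 1, \<dots>, ed l\<close> are cut out of the base graph \<open>ends\<^sub>0\<close>, directed from \<open>ini i\<close> to
  \<open>ter i\<close>. The skeleton has vertex type \<open>'g\<close>, and \<open>\<sigma> i u\<close> is \<open>u + e_i\<close>. The skeleton describes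
  the cover \<open>ends\<close> when \<open>\<phi> u v\<close>, \<open>\<psi> u e\<close> enumerate the vertices and edges of the cover lying
  over \<open>v\<close>, \<open>e\<close>, such that the edges of the tree stay within the block at \<open>u\<close>, while \<open>\<psi> u (ed i)\<close>
  is the gluing of the half-edge \<open>e_i^+\<close> of the block at \<open>u\<close> to \<open>e_i^-\<close> of the block at
  \<open>u + e_i\<close>.
\<close>

definition skeleton_of_cover ::
  "('e \<Rightarrow> 'v uprod) \<Rightarrow> nat \<Rightarrow> (nat \<Rightarrow> 'e) \<Rightarrow> (nat \<Rightarrow> 'v) \<Rightarrow> (nat \<Rightarrow> 'v) \<Rightarrow>
   ('y \<Rightarrow> 'x uprod) \<Rightarrow> ('x \<Rightarrow> 'v) \<Rightarrow> ('y \<Rightarrow> 'e) \<Rightarrow>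
   (nat \<Rightarrow> 'g \<Rightarrow> 'g) \<Rightarrow> ('g \<Rightarrow> 'v \<Rightarrow> 'x) \<Rightarrow> ('g \<Rightarrow> 'e \<Rightarrow> 'y) \<Rightarrow> bool" where
  "skeleton_of_cover ends\<^sub>0 l ed ini ter ends \<pi>V \<pi>E \<sigma> \<phi> \<psi> \<longleftrightarrow>
     (\<forall>i\<in>{1..l}. bij (\<sigma> i)) \<and>
     bij (\<lambda>(u, v). \<phi> u v) \<and> bij (\<lambda>(u, e). \<psi> u e) \<and>
     (\<forall>u v. \<pi>V (\<phi> u v) = v) \<and> (\<forall>u e. \<pi>E (\<psi> u e) = e) \<and>
     (\<forall>u. \<forall>e. e \<notin> ed ` {1..l} \<longrightarrow> ends (\<psi> u e) = map_uprod (\<phi> u) (ends\<^sub>0 e)) \<and>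
     (\<forall>u. \<forall>i\<in>{1..l}. ends (\<psi> u (ed i)) = Upair (\<phi> u (ini i)) (\<phi> (\<sigma> i u) (ter i)))"

text \<open>The edges of the skeleton are the pairs \<open>(u, i)\<close> with \<open>1 \<le> i \<le> l\<close>.\<close>

definition skel_edges :: "nat \<Rightarrow> ('g \<times> nat) set" where
  "skel_edges l = UNIV \<times> {1..l}"

fun skel_ends :: "(nat \<Rightarrow> 'g \<Rightarrow> 'g) \<Rightarrow> 'g \<times> nat \<Rightarrow> 'g uprod" where
  "skel_ends \<sigma> (u, i) = Upair u (\<sigma> i u)"

text \<open>The operator on \<open>\<complex>\<^sup>p\<close>-valued functions on the skeleton.\<close>

definition block_operator ::
  "nat \<Rightarrow> complex^'v^'v \<Rightarrow> (nat \<Rightarrow> complex^'v^'v) \<Rightarrow> (nat \<Rightarrow> 'g \<Rightarrow> 'g) \<Rightarrow>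
   complex^'v^'g \<Rightarrow> complex^'v^'g" where
  "block_operator l B A \<sigma> x = (\<chi> u. B *v (x $ u) +
     (\<Sum>i = 1..l. A i *v (x $ \<sigma> i u) + ctranspose (A i) *v (x $ inv (\<sigma> i) u)))"

text \<open>The identification of \<open>L\<^sup>2\<close> of the cover with \<open>L\<^sup>2(G, \<complex>\<^sup>p)\<close>.\<close>

definition to_blocks :: "('g \<Rightarrow> 'v \<Rightarrow> 'x) \<Rightarrow> complex^'x \<Rightarrow> complex^'v^'g" where
  "to_blocks \<phi> x = (\<chi> u v. x $ \<phi> u v)"


section \<open>The block description of the lift\<close>

text \<open>
  \<open>J\<^sub>0 = B + \<Sum>\<^sub>i (A\<^sub>i + A\<^sub>i\<^sup>*)\<close>, and the lift of \<open>J\<^sub>0\<close> to a cover acts on \<open>L\<^sup>2(G, \<complex>\<^sup>p)\<close> as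
  the block operator of any skeleton of the cover.
\<close>

lemma jacobi_on_entry:
  fixes ends :: "'e::finite \<Rightarrow> 'v::finite uprod"
  assumes st: "\<And>e. e \<in> F \<Longrightarrow> ends e = Upair (s e) (t e)"
  shows "jacobi_on F ends a b $ v $ w = of_bool (v = w) * of_real (b v) +
    (\<Sum>e\<in>F. of_real (a e) * (of_bool (s e = v \<and> t e = w) + of_bool (t e = v \<and> s e = w)))"
proof (cases "v = w")
  case True
  have "(\<Sum>e | e \<in> F \<and> ends e = Upair v v. a e) = (\<Sum>e\<in>F. a e * of_bool (s e = v \<and> t e = v))"
    by (rule sum.mono_neutral_cong_left) (auto simp: st)
  then show ?thesis
    using True
    by (simp add: jacobi_on_def sum_distrib_left conj_commute del: sum_of_bool_mult_eq sum_mult_of_bool_eq)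
      (rule sum.cong; simp)
next
  case False
  have "(\<Sum>e | e \<in> F \<and> ends e = Upair v w. a e) =
      (\<Sum>e\<in>F. a e * (of_bool (s e = v \<and> t e = w) + of_bool (t e = v \<and> s e = w)))"
    by (rule sum.mono_neutral_cong_left) (use False in \<open>auto simp: st\<close>)
  moreover have "complex_of_real (of_bool P) = of_bool P" for P
    by (cases P) auto
  ultimately show ?thesis
    using False by (simp add: jacobi_on_def)
qed

lemma jacobi_on_mult:
  fixes ends :: "'e::finite \<Rightarrow> 'v::finite uprod"
  assumes st: "\<And>e. e \<in> F \<Longrightarrow> ends e = Upair (s e) (t e)"
  shows "(jacobi_on F ends a b *v x) $ v = of_real (b v) * x $ v +
    (\<Sum>e\<in>F. of_real (a e) * (of_bool (s e = v) * x $ t e + of_bool (t e = v) * x $ s e))"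
proof -
  have "(\<Sum>w\<in>UNIV. (\<Sum>e\<in>F. of_real (a e) *
          (of_bool (s e = v \<and> t e = w) + of_bool (t e = v \<and> s e = w))) * x $ w) =
        (\<Sum>e\<in>F. \<Sum>w\<in>UNIV. of_real (a e) *
          (of_bool (s e = v \<and> t e = w) + of_bool (t e = v \<and> s e = w)) * x $ w)"
    by (simp only: sum_distrib_right) (rule sum.swap)
  also have "\<dots> = (\<Sum>e\<in>F. of_real (a e) * (of_bool (s e = v) * x $ t e + of_bool (t e = v) * x $ s e))"
  proof (rule sum.cong [OF refl])
    fix e
    have "(\<Sum>w\<in>UNIV. of_real (a e) *
        (of_bool (s e = v \<and> t e = w) + of_bool (t e = v \<and> s e = w)) * x $ w) =
       of_real (a e) * of_bool (s e = v) * (\<Sum>w\<in>UNIV. if t e = w then x $ w else 0) +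
       of_real (a e) * of_bool (t e = v) * (\<Sum>w\<in>UNIV. if s e = w then x $ w else 0)"
      unfolding sum_distrib_left sum.distrib [symmetric]
      by (rule sum.cong) (auto simp: algebra_simps)
    then show "(\<Sum>w\<in>UNIV. of_real (a e) *
        (of_bool (s e = v \<and> t e = w) + of_bool (t e = v \<and> s e = w)) * x $ w) =
       of_real (a e) * (of_bool (s e = v) * x $ t e + of_bool (t e = v) * x $ s e)"
      by (simp add: algebra_simps)
  qed
  finally have *: "(\<Sum>w\<in>UNIV. (\<Sum>e\<in>F. of_real (a e) *
          (of_bool (s e = v \<and> t e = w) + of_bool (t e = v \<and> s e = w))) * x $ w) = \<dots>" .
  have "(\<Sum>w\<in>UNIV. of_bool (v = w) * of_real (b v) * x $ w) =
      (\<Sum>w\<in>UNIV. if v = w then of_real (b v) * x $ w else 0)"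
    by (rule sum.cong) auto
  then have **: "(\<Sum>w\<in>UNIV. of_bool (v = w) * of_real (b v) * x $ w) = of_real (b v) * x $ v"
    by simp
  have dist: "(\<Sum>w\<in>UNIV. (f w + g w) * h w) = (\<Sum>w\<in>UNIV. f w * h w) + (\<Sum>w\<in>UNIV. g w * h w)"
    for f g h :: "'v \<Rightarrow> complex"
    by (simp add: distrib_right sum.distrib)
  show ?thesis
    unfolding matrix_vector_mult_def vec_lambda_beta
    by (subst jacobi_on_entry [of F ends s t, OF st], assumption) (simp only: dist * **)
qed

lemma elementary_matrix_entry:
  "elementary_matrix p q c $ v $ w = of_real c * of_bool (p = v \<and> q = w)"
  by (cases "p = v"; cases "q = w"; simp add: elementary_matrix_def; blast)

lemma ctranspose_elementary_matrix:
  "ctranspose (elementary_matrix p q c) = elementary_matrix q p c"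
  unfolding vec_eq_iff ctranspose_def vec_lambda_beta elementary_matrix_entry
  by (cases "p = w"; cases "q = v"; simp)

lemma elementary_matrix_mult:
  fixes p q v :: "'v::finite"
  shows "(elementary_matrix p q c *v z) $ v = of_real c * (of_bool (p = v) * z $ q)"
proof -
  have "(elementary_matrix p q c *v z) $ v =
      (\<Sum>w\<in>UNIV. if w = q then of_real c * (of_bool (p = v) * z $ w) else 0)"
    unfolding matrix_vector_mult_def elementary_matrix_entry vec_lambda_beta
    by (rule sum.cong) auto
  then show ?thesis by simp
qed

theorem jacobi_block_decomposition:
  fixes ends\<^sub>0 :: "'e::finite \<Rightarrow> 'v::finite uprod"
  assumes inj: "inj_on ed {1..l}"
    and dir: "\<And>i. i \<in> {1..l} \<Longrightarrow> ends\<^sub>0 (ed i) = Upair (ini i) (ter i)"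
  shows "jacobi ends\<^sub>0 a b = jacobi_on (- ed ` {1..l}) ends\<^sub>0 a b +
    (\<Sum>i = 1..l. elementary_matrix (ini i) (ter i) (a (ed i)) +
       ctranspose (elementary_matrix (ini i) (ter i) (a (ed i))))"
proof -
  let ?R = "ed ` {1..l}"
  define ix where "ix = the_inv_into {1..l} ed"
  have ix: "ix (ed i) = i" if "i \<in> {1..l}" for i
    using the_inv_into_f_f [OF inj that] by (simp only: ix_def)
  define pr where "pr = (\<lambda>e. SOME p. ends\<^sub>0 e = Upair (fst p) (snd p))"
  have pr: "ends\<^sub>0 e = Upair (fst (pr e)) (snd (pr e))" for e
  proof -
    obtain p q where "ends\<^sub>0 e = Upair p q" by (rule uprod_exhaust)
    then have "ends\<^sub>0 e = Upair (fst (p, q)) (snd (p, q))" by simp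
    then show ?thesis unfolding pr_def by (rule someI)
  qed
  define s where "s = (\<lambda>e. if e \<in> ?R then ini (ix e) else fst (pr e))"
  define t where "t = (\<lambda>e. if e \<in> ?R then ter (ix e) else snd (pr e))"
  have ed: "s (ed i) = ini i" "t (ed i) = ter i" if "i \<in> {1..l}" for i
    using ix [OF that] imageI [OF that, of ed] by (simp_all only: s_def t_def if_True)
  have st: "ends\<^sub>0 e = Upair (s e) (t e)" for e
  proof (cases "e \<in> ?R")
    case True
    then obtain i where "e = ed i" "i \<in> {1..l}" by (rule imageE)
    then show ?thesis using dir ed by simp
  next
    case False
    then show ?thesis using pr by (simp only: s_def t_def if_False)
  qed
  let ?f = "\<lambda>v w e. complex_of_real (a e) * (of_bool (s e = v \<and> t e = w) + of_bool (t e = v \<and> s e = w))"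
  have split: "sum (?f v w) UNIV = sum (?f v w) (- ed ` {1..l}) + (\<Sum>i = 1..l. ?f v w (ed i))" for v w
    using sum.subset_diff [of ?R UNIV "?f v w"] sum.reindex [OF inj, of "?f v w"]
    by (simp only: subset_UNIV finite Compl_eq_Diff_UNIV o_def simp_thms)
  have "(\<Sum>i = 1..l. ?f v w (ed i)) = (\<Sum>i = 1..l. elementary_matrix (ini i) (ter i) (a (ed i)) +
       ctranspose (elementary_matrix (ini i) (ter i) (a (ed i)))) $ v $ w" for v w
    unfolding sum_component
    by (rule sum.cong [OF refl])
      (simp only: vector_add_component ctranspose_elementary_matrix elementary_matrix_entry ed distrib_left)
  then show ?thesis
    by (subst vec_eq_iff, subst vec_eq_iff)
      (simp only: vector_add_component jacobi_on_entry [of _ ends\<^sub>0 s t, OF st] split add.assoc simp_thms)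
qed

theorem lift_eq_block_operator:
  fixes ends\<^sub>0 :: "'e::finite \<Rightarrow> 'v::finite uprod"
    and ends :: "'y::finite \<Rightarrow> 'x::finite uprod"
    and \<sigma> :: "nat \<Rightarrow> 'g::finite \<Rightarrow> 'g"
  assumes inj: "inj_on ed {1..l}"
    and dir: "\<And>i. i \<in> {1..l} \<Longrightarrow> ends\<^sub>0 (ed i) = Upair (ini i) (ter i)"
    and skel: "skeleton_of_cover ends\<^sub>0 l ed ini ter ends \<pi>V \<pi>E \<sigma> \<phi> \<psi>"
  shows "to_blocks \<phi> (jacobi ends (a \<circ> \<pi>E) (b \<circ> \<pi>V) *v x) =
    block_operator l (jacobi_on (- ed ` {1..l}) ends\<^sub>0 a b)
      (\<lambda>i. elementary_matrix (ini i) (ter i) (a (ed i))) \<sigma> (to_blocks \<phi> x)"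
proof -
  let ?R = "ed ` {1..l}"
  define ix where "ix = the_inv_into {1..l} ed"
  have ix: "ix (ed i) = i" if "i \<in> {1..l}" for i
    using the_inv_into_f_f [OF inj that] by (simp only: ix_def)
  define pr where "pr = (\<lambda>e. SOME p. ends\<^sub>0 e = Upair (fst p) (snd p))"
  have pr: "ends\<^sub>0 e = Upair (fst (pr e)) (snd (pr e))" for e
  proof -
    obtain p q where "ends\<^sub>0 e = Upair p q" by (rule uprod_exhaust)
    then have "ends\<^sub>0 e = Upair (fst (p, q)) (snd (p, q))" by simp
    then show ?thesis unfolding pr_def by (rule someI)
  qed
  define s where "s = (\<lambda>e. if e \<in> ?R then ini (ix e) else fst (pr e))"
  define t where "t = (\<lambda>e. if e \<in> ?R then ter (ix e) else snd (pr e))"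
  define \<tau> where "\<tau> = (\<lambda>e. if e \<in> ?R then \<sigma> (ix e) else id)"
  have ed: "s (ed i) = ini i" "t (ed i) = ter i" "\<tau> (ed i) = \<sigma> i" if "i \<in> {1..l}" for i
    using ix [OF that] imageI [OF that, of ed] by (simp_all only: s_def t_def \<tau>_def if_True)
  have st: "ends\<^sub>0 e = Upair (s e) (t e)" for e
  proof (cases "e \<in> ?R")
    case True
    then obtain i where "e = ed i" "i \<in> {1..l}" by (rule imageE)
    then show ?thesis using dir ed by simp
  next
    case False
    then show ?thesis using pr by (simp only: s_def t_def if_False)
  qed
  have \<tau>: "bij (\<tau> e)" "e \<notin> ?R \<Longrightarrow> \<tau> e = id" for e
    using skel by (auto simp: \<tau>_def ix skeleton_of_cover_def)
  have \<phi>: "bij (\<lambda>(u, v). \<phi> u v)" and \<psi>: "bij (\<lambda>(u, e). \<psi> u e)"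
    and \<pi>: "\<And>u v. \<pi>V (\<phi> u v) = v" "\<And>u e. \<pi>E (\<psi> u e) = e"
    using skel by (auto simp: skeleton_of_cover_def)
  have \<phi>_eq: "\<phi> u v = \<phi> u' v' \<longleftrightarrow> u = u' \<and> v = v'" for u v u' v'
    using bij_is_inj [OF \<phi>] by (auto simp: inj_def)
  have ends: "ends (\<psi> u e) = Upair (\<phi> u (s e)) (\<phi> (\<tau> e u) (t e))" for u e
  proof (cases "e \<in> ?R")
    case True
    then obtain i where "i \<in> {1..l}" "e = ed i" by blast
    then show ?thesis using skel ed by (simp add: skeleton_of_cover_def)
  next
    case False
    then show ?thesis using skel by (simp add: skeleton_of_cover_def \<tau> st)
  qed
  define q where "q = inv (\<lambda>(u, e). \<psi> u e)"
  have q: "q (\<psi> u e) = (u, e)" for u e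
    using inv_f_f [OF bij_is_inj [OF \<psi>], of "(u, e)"] by (simp add: q_def)
  define S where "S = (\<lambda>y. case q y of (u, e) \<Rightarrow> \<phi> u (s e))"
  define T where "T = (\<lambda>y. case q y of (u, e) \<Rightarrow> \<phi> (\<tau> e u) (t e))"
  have ST: "ends y = Upair (S y) (T y)" for y
  proof -
    obtain u e where "y = \<psi> u e" using bij_is_surj [OF \<psi>] by (metis surj_def case_prod_conv surj_pair)
    then show ?thesis by (simp add: S_def T_def q ends)
  qed
  let ?g = "\<lambda>u v e. complex_of_real (a e) * (of_bool (s e = v) * x $ \<phi> (\<tau> e u) (t e) +
      of_bool (t e = v) * x $ \<phi> (inv (\<tau> e) u) (s e))"
  have main: "(jacobi ends (a \<circ> \<pi>E) (b \<circ> \<pi>V) *v x) $ \<phi> u v =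
     of_real (b v) * x $ \<phi> u v + sum (?g u v) UNIV" for u v
  proof -
    let ?h = "\<lambda>y. complex_of_real (a (\<pi>E y)) * (of_bool (S y = \<phi> u v) * x $ T y + of_bool (T y = \<phi> u v) * x $ S y)"
    have "sum ?h UNIV = (\<Sum>(u', e)\<in>UNIV. ?h (\<psi> u' e))"
      by (subst sum.reindex_bij_betw [OF \<psi>, symmetric]) (rule sum.cong; clarsimp)
    also have "\<dots> = (\<Sum>e\<in>UNIV. \<Sum>u'\<in>UNIV. ?h (\<psi> u' e))"
      unfolding UNIV_Times_UNIV [symmetric]
      by (subst sum.cartesian_product [symmetric]) (rule sum.swap)
    also have "\<dots> = sum (?g u v) UNIV"
    proof (rule sum.cong [OF refl])
      fix e
      have inv: "\<tau> e u' = u \<longleftrightarrow> u' = inv (\<tau> e) u" for u'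
        using \<tau>(1) [of e] by (metis bij_inv_eq_iff)
      have "(\<Sum>u'\<in>UNIV. ?h (\<psi> u' e)) = (\<Sum>u'\<in>UNIV.
          (if u' = u then a e * (of_bool (s e = v) * x $ \<phi> (\<tau> e u') (t e)) else 0) +
          (if u' = inv (\<tau> e) u then a e * (of_bool (t e = v) * x $ \<phi> u' (s e)) else 0))"
        by (rule sum.cong) (auto simp: S_def T_def q \<pi> \<phi>_eq inv distrib_left)
      then show "(\<Sum>u'\<in>UNIV. ?h (\<psi> u' e)) = ?g u v e"
        by (simp add: sum.distrib distrib_left)
    qed
    finally show ?thesis
      by (subst jacobi_on_mult [of _ ends S T, OF ST]) (simp only: o_def \<pi>)
  qed
  have "sum (?g u v) UNIV = sum (?g u v) (- ?R) + (\<Sum>i = 1..l. ?g u v (ed i))" for u v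
    using sum.subset_diff [of ?R UNIV "?g u v"] sum.reindex [OF inj, of "?g u v"]
    by (simp only: subset_UNIV finite Compl_eq_Diff_UNIV o_def simp_thms)
  moreover have "(jacobi_on (- ?R) ends\<^sub>0 a b *v (to_blocks \<phi> x $ u)) $ v =
      of_real (b v) * x $ \<phi> u v + sum (?g u v) (- ?R)" for u v
    by (subst jacobi_on_mult [of _ ends\<^sub>0 s t, OF st], simp add: to_blocks_def, rule sum.cong)
      (auto simp: \<tau>)
  ultimately show ?thesis
    unfolding block_operator_def ctranspose_elementary_matrix
    by (subst vec_eq_iff, subst vec_eq_iff)
      (simp add: to_blocks_def main ed distrib_left elementary_matrix_mult del: One_nat_def)
qed

end

theory Submission
  imports Defs
begin

text \<open>
  On the universal cover of the skeleton, a \<open>d\<close>-regular tree, take the radial function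
  \<open>(d - 1) powr (- n / 2)\<close> of the distance \<open>n < r\<close> to a lift of the edge \<open>\<epsilon>\<close>, and push it down to
  the skeleton by taking the \<open>L\<^sup>2\<close> norm over each fibre. Norms are preserved, and by
  Cauchy--Schwarz the edge sums \<open>\<Sum> F u * F (u + e\<^sub>i)\<close> do not decrease, so cycles in the
  skeleton do no harm. On the tree the edges of type \<open>i\<close> between consecutive spheres are
  equidistributed up to an alternating error of constant size, created by the special role of
  \<open>j\<close> at the centre; weighted by the decaying radial function, it costs at most the absolute
  value in \<open>C\<close>. The functions \<open>F u * y\<close> obtained from \<open>\<epsilon>\<^sub>1\<close> and \<open>\<epsilon>\<^sub>2\<close> have disjoint,
  non-adjacent supports, so the Rayleigh quotient bound holds on their span.
\<close>

section \<open>Lower bounds for the second eigenvalue\<close>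

text \<open>A maximiser \<open>v\<close> of the Rayleigh quotient over the unit sphere of the
  invariant subspace \<open>T\<close> is an eigenvector; its eigenvalue is the maximum, hence at
  least \<open>\<mu>\<close> because of \<open>w\<close>.\<close>

lemma self_adjoint_eigenvector_in_subspace:
  fixes f :: "'a::euclidean_space \<Rightarrow> 'a"
  assumes lin: "linear f" and sa: "\<And>x y. f x \<bullet> y = x \<bullet> f y"
    and T: "subspace T" "f ` T \<subseteq> T"
    and w: "w \<in> T" "w \<noteq> 0" "f w \<bullet> w \<ge> \<mu> * (w \<bullet> w)"
  obtains v s where "v \<in> T" "v \<noteq> 0" "s \<ge> \<mu>" "f v = s *\<^sub>R v"
proof -
  let ?K = "sphere 0 1 \<inter> T"
  have w': "(1 / norm w) *\<^sub>R w \<in> ?K"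
    using w T by (auto simp: subspace_scale)
  have "compact ?K"
    using closed_subspace [OF T(1)] by (simp add: compact_Int_closed)
  moreover have "continuous_on ?K (\<lambda>x. f x \<bullet> x)"
    using lin by (intro continuous_intros linear_continuous_on) (simp add: linear_linear)
  ultimately obtain v where v: "v \<in> ?K" and max: "\<And>x. x \<in> ?K \<Longrightarrow> f x \<bullet> x \<le> f v \<bullet> v"
    using continuous_attains_sup [of ?K "\<lambda>x. f x \<bullet> x"] w' by (metis empty_iff)
  define s where "s = f v \<bullet> v"
  have scale: "f (c *\<^sub>R x) = c *\<^sub>R f x" and add: "f (x + z) = f x + f z" for c x z
    using lin by (simp_all add: linear_cmul linear_add)
  have bound: "f x \<bullet> x \<le> s * (x \<bullet> x)" if "x \<in> T" for x
  proof (cases "x = 0")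
    case True then show ?thesis by simp
  next
    case False
    have "(1 / norm x) *\<^sub>R x \<in> ?K" using False that T by (auto simp: subspace_scale)
    from max [OF this] have "(f x \<bullet> x) / (norm x)\<^sup>2 \<le> s"
      by (simp add: scale s_def power2_eq_square divide_simps)
    then show ?thesis using False by (simp add: divide_simps power2_norm_eq_inner)
  qed
  have vT: "v \<in> T" and vv: "v \<bullet> v = 1" and v0: "v \<noteq> 0"
    using v by (auto simp: dot_square_norm)
  \<comment> \<open>The residual \<open>h\<close> lies in \<open>T\<close>, so \<open>v\<close> may
    be perturbed along it. The first-order gain is \<open>2 * t * (h \<bullet> h)\<close>, which
    maximality forbids unless \<open>h = 0\<close>.\<close>
  define h where "h = f v - s *\<^sub>R v"
  have hT: "h \<in> T"
    using T vT by (auto simp: h_def intro!: subspace_diff subspace_scale)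
  have hv: "f v \<bullet> h - s * (v \<bullet> h) = h \<bullet> h"
    by (simp add: h_def inner_diff_left inner_diff_right algebra_simps inner_commute)
  have *: "2 * t * (h \<bullet> h) \<le> t\<^sup>2 * (s * (h \<bullet> h) - f h \<bullet> h)" for t
  proof -
    have fx: "f (v + t *\<^sub>R h) \<bullet> (v + t *\<^sub>R h) = s + 2 * t * (f v \<bullet> h) + t\<^sup>2 * (f h \<bullet> h)"
      using sa [of h v] unfolding s_def
      by (simp add: add scale inner_add_left inner_add_right inner_commute power2_eq_square algebra_simps)
    have xx: "(v + t *\<^sub>R h) \<bullet> (v + t *\<^sub>R h) = 1 + 2 * t * (v \<bullet> h) + t\<^sup>2 * (h \<bullet> h)"
      using vv by (simp add: inner_add_left inner_add_right inner_commute power2_eq_square algebra_simps)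
    have "v + t *\<^sub>R h \<in> T" using vT hT T by (intro subspace_add subspace_scale)
    from bound [OF this] show ?thesis unfolding fx xx hv [symmetric]
      by (simp add: algebra_simps)
  qed
  have "h \<bullet> h = 0"
  proof (rule ccontr)
    assume "h \<bullet> h \<noteq> 0"
    then have pos: "h \<bullet> h > 0" by simp
    define D where "D = s * (h \<bullet> h) - f h \<bullet> h"
    \<comment> \<open>With this \<open>t\<close> the second-order term is at most
      \<open>h \<bullet> h\<close> after division by \<open>t\<close>, half of what it must
      outweigh.\<close>
    define t where "t = (h \<bullet> h) / (\<bar>D\<bar> + 1)"
    have t: "t > 0" using pos by (simp add: t_def divide_pos_pos)
    have "2 * (h \<bullet> h) \<le> t * D"
      using * [of t] t unfolding D_def [symmetric] by (simp add: power2_eq_square)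
    also have "\<dots> \<le> t * (\<bar>D\<bar> + 1)" using t by (intro mult_left_mono) auto
    also have "\<dots> = h \<bullet> h" by (simp add: t_def)
    finally show False using pos by simp
  qed
  then have eq: "f v = s *\<^sub>R v" by (simp add: h_def)
  have "\<mu> * (w \<bullet> w) \<le> s * (w \<bullet> w)" using w(3) bound [OF w(1)] by linarith
  then have "\<mu> \<le> s" using w(2) by simp
  then show thesis using that vT v0 eq by blast
qed

section \<open>The Hermitian form, with the Euclidean inner product as its real part\<close>

lemma inner_eq_Re_cinner: "(x :: complex^'n) \<bullet> y = Re (cinner x y)"
  by (simp add: inner_vec_def cinner_def inner_complex_def)

lemma cinner_add_left: "cinner (x + y) z = cinner x z + cinner y z"
  by (simp add: cinner_def distrib_right sum.distrib)

lemma cinner_add_right: "cinner x (y + z) = cinner x y + cinner x z"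
  by (simp add: cinner_def distrib_left sum.distrib)

lemma cinner_scale_left: "cinner (c *s x) z = c * cinner x z"
  by (simp add: cinner_def sum_distrib_left mult.assoc)

lemma cinner_scale_right: "cinner x (c *s z) = cnj c * cinner x z"
  by (simp add: cinner_def sum_distrib_left mult_ac)

lemma cinner_sum_left: "cinner (sum f S) z = (\<Sum>i\<in>S. cinner (f i) z)"
  unfolding cinner_def by (simp add: sum_distrib_right) (rule sum.swap)

lemma cnj_cinner: "cnj (cinner x y) = cinner y x"
  by (simp add: cinner_def mult.commute)

lemma cinner_ctranspose: "cinner (M *v x) y = cinner x (ctranspose M *v y)"
  unfolding cinner_def matrix_vector_mult_def ctranspose_def
  by (simp add: sum_distrib_left sum_distrib_right mult_ac) (rule sum.swap)

lemma scaleR_eq_of_real_scale: "c *\<^sub>R (x :: complex^'n) = of_real c *s x"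
  by (simp add: vec_eq_iff scaleR_conv_of_real [where 'a = complex])

lemma linear_matrix_vector_mult: "linear ((*v) (M :: complex^'n^'m))"
  by (rule linearI)
    (simp_all add: matrix_vector_right_distrib scaleR_eq_of_real_scale vector_scalar_commute)

text \<open>Eigenvectors for distinct real eigenvalues are orthogonal, hence independent over the
  reals. Finiteness matters because a sum over an infinite index set defaults to zero, which would
  empty \<open>eigenvalue_list\<close>.\<close>

lemma finite_eigenvalues:
  assumes "ctranspose M = (M :: complex^'n^'n)"
  shows "finite {s. eigenspace M (of_real s) \<noteq> {0}}"
proof -
  let ?S = "{s. eigenspace M (of_real s) \<noteq> {0}}"
  have "\<exists>x. x \<noteq> 0 \<and> M *v x = of_real s *s x" if "s \<in> ?S" for s
    using that by (auto simp: eigenspace_def)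
  then obtain g where g: "\<And>s. s \<in> ?S \<Longrightarrow> g s \<noteq> 0 \<and> M *v g s = of_real s *s g s"
    by metis
  have orth: "g s \<bullet> g t = 0" if "s \<in> ?S" "t \<in> ?S" "s \<noteq> t" for s t
  proof -
    have "cinner (M *v g s) (g t) = cinner (g s) (M *v g t)"
      using cinner_ctranspose [of M] assms by simp
    then have "of_real s * cinner (g s) (g t) = of_real t * cinner (g s) (g t)"
      using g that by (simp add: cinner_scale_left cinner_scale_right)
    then show ?thesis using that(3) by (simp add: inner_eq_Re_cinner)
  qed
  have "inj_on g ?S"
    using orth g by (metis (no_types, lifting) inj_onI inner_eq_zero_iff)
  moreover have "independent (g ` ?S)"
  proof (rule pairwise_orthogonal_independent)
    show "pairwise orthogonal (g ` ?S)"
      using orth by (auto simp: pairwise_def orthogonal_def)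
    show "0 \<notin> g ` ?S"
      using g by fastforce
  qed
  ultimately show ?thesis
    using independent_imp_finite finite_imageD by blast
qed

text \<open>In decreasing order, a second entry below \<open>\<mu>\<close> forces all later ones
  below it, leaving at most one that reaches \<open>\<mu>\<close>. Lists count from 0, so index 1 is
  the second entry.\<close>

lemma rev_sorted_nth_one_ge:
  assumes "sorted xs" "length (filter (\<lambda>s. \<mu> \<le> s) xs) \<ge> 2"
  shows "\<mu> \<le> rev xs ! 1"
proof -
  define ys where "ys = rev xs"
  have s: "sorted_wrt (\<ge>) ys" using assms(1) by (simp add: ys_def sorted_wrt_rev)
  have l: "length (filter (\<lambda>s. \<mu> \<le> s) ys) \<ge> 2"
    using assms(2) by (simp add: ys_def rev_filter [symmetric])
  obtain x y zs where ys: "ys = x # y # zs"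
    using l by (cases ys; cases "tl ys") (auto split: if_splits)
  have "\<mu> \<le> y"
  proof (rule ccontr)
    assume "\<not> \<mu> \<le> y"
    then have "filter (\<lambda>s. \<mu> \<le> s) (y # zs) = []"
      using s ys by (force simp: filter_empty_conv)
    then have "length (filter (\<lambda>s. \<mu> \<le> s) ys) \<le> 1" using ys by simp
    then show False using l by simp
  qed
  then show ?thesis by (simp add: ys flip: ys_def)
qed

text \<open>At most one of the sets has positive dimension, and that one spans a line. A single
  vector thus serves as the only constraint in the variational argument below.\<close>

lemma subset_span_singleton_of_dim_sum_le_one:
  fixes V :: "'i \<Rightarrow> (complex^'n) set"
  assumes fin: "finite S" and sum: "(\<Sum>s\<in>S. vec.dim (V s)) \<le> 1"
  obtains e where "\<And>s. s \<in> S \<Longrightarrow> V s \<subseteq> vec.span {e}"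
proof (cases "\<exists>t\<in>S. vec.dim (V t) > 0")
  case False
  then have "V s \<subseteq> vec.span {0}" if "s \<in> S" for s
    using that vec.dim_eq_0 by auto
  then show thesis by (rule that)
next
  case True
  then obtain t where t: "t \<in> S" "vec.dim (V t) > 0" by blast
  have split: "(\<Sum>s\<in>S. vec.dim (V s)) = vec.dim (V t) + (\<Sum>s\<in>S - {t}. vec.dim (V s))"
    using fin t by (simp add: sum.remove)
  then have "vec.dim (V t) = 1" using sum t by linarith
  then obtain e where e: "V t \<subseteq> vec.span {e}"
    using vec.basis_exists [of "V t"] by (metis card_1_singletonE)
  have "(\<Sum>s\<in>S - {t}. vec.dim (V s)) = 0"
    using split sum t by linarith
  then have "vec.dim (V s) = 0" if "s \<in> S - {t}" for s
    using that fin by (simp only: sum_eq_0_iff finite_Diff)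
  then have "V s \<subseteq> vec.span {e}" if "s \<in> S" for s
    using that e vec.dim_eq_0 vec.span_zero by (cases "s = t") force+
  then show thesis by (rule that)
qed

text \<open>The min-max principle on the complex span of the two vectors: orthogonality removes all
  cross terms, so the Rayleigh bound extends to every combination.\<close>

theorem eigval_2_ge:
  fixes M :: "complex^'n^'n"
  assumes herm: "ctranspose M = M"
    and nz: "x\<^sub>1 \<noteq> 0" "x\<^sub>2 \<noteq> 0"
    and orth: "cinner x\<^sub>1 x\<^sub>2 = 0" "cinner (M *v x\<^sub>1) x\<^sub>2 = 0"
    and ge: "Re (cinner (M *v x\<^sub>1) x\<^sub>1) \<ge> \<mu> * (norm x\<^sub>1)\<^sup>2" "Re (cinner (M *v x\<^sub>2) x\<^sub>2) \<ge> \<mu> * (norm x\<^sub>2)\<^sup>2"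
  shows "eigval 2 M \<ge> \<mu>"
proof -
  let ?E = "\<lambda>s. eigenspace M (complex_of_real s)"
  define S where "S = {s. ?E s \<noteq> {0} \<and> \<mu> \<le> s}"
  have fin: "finite S"
    using finite_eigenvalues [OF herm] by (rule rev_finite_subset) (auto simp: S_def)
  have sa: "cinner (M *v x) z = cinner x (M *v z)" for x z
    using cinner_ctranspose [of M] herm by simp
  have two: "(\<Sum>s\<in>S. vec.dim (?E s)) \<ge> 2"
  proof (rule ccontr)
    assume "\<not> (\<Sum>s\<in>S. vec.dim (?E s)) \<ge> 2"
    then have "(\<Sum>s\<in>S. vec.dim (?E s)) \<le> 1" by simp
    then obtain e where e: "\<And>s. s \<in> S \<Longrightarrow> ?E s \<subseteq> vec.span {e}"
      using subset_span_singleton_of_dim_sum_le_one [OF fin, of ?E] by blast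
    \<comment> \<open>\<open>T\<close> is the orthogonal complement of the eigenspaces for
      eigenvalues at least \<open>\<mu>\<close>; such an eigenvector found inside \<open>T\<close>
      is orthogonal to itself.\<close>
    define T where "T = {x. \<forall>s\<in>S. \<forall>z\<in>?E s. x \<bullet> z = 0}"
    have T: "subspace T"
      by (auto simp: T_def subspace_def inner_add_left)
    have "M *v x \<in> T" if "x \<in> T" for x
    proof -
      have "(M *v x) \<bullet> z = 0" if "s \<in> S" "z \<in> ?E s" for s z
      proof -
        have "(M *v x) \<bullet> z = x \<bullet> (s *\<^sub>R z)"
          using that(2) by (simp add: inner_eq_Re_cinner sa eigenspace_def scaleR_eq_of_real_scale)
        then show ?thesis using \<open>x \<in> T\<close> that by (simp add: T_def)
      qed
      then show ?thesis by (simp add: T_def)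
    qed
    then have MT: "(*v) M ` T \<subseteq> T" by auto
    \<comment> \<open>Two unknowns against one linear equation: some nontrivial combination is
      orthogonal to \<open>e\<close>, hence to all these eigenspaces.\<close>
    obtain c\<^sub>1 c\<^sub>2 where c: "c\<^sub>1 * cinner x\<^sub>1 e + c\<^sub>2 * cinner x\<^sub>2 e = 0" "c\<^sub>1 \<noteq> 0 \<or> c\<^sub>2 \<noteq> 0"
    proof (cases "cinner x\<^sub>1 e = 0")
      case True
      then show thesis using that [of 1 0] by simp
    next
      case False
      then show thesis using that [of "- cinner x\<^sub>2 e" "cinner x\<^sub>1 e"] by simp
    qed
    define w where "w = c\<^sub>1 *s x\<^sub>1 + c\<^sub>2 *s x\<^sub>2"
    have orth': "cinner x\<^sub>2 x\<^sub>1 = 0" "cinner (M *v x\<^sub>2) x\<^sub>1 = 0"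
      using orth cnj_cinner sa by (metis complex_cnj_zero)+
    have sq: "Re (c * (cnj c * z)) = (cmod c)\<^sup>2 * Re z" for c z
      by (simp flip: mult.assoc complex_norm_square)
    then have sq': "Re (cnj c * (c * z)) = (cmod c)\<^sup>2 * Re z" for c z
      by (metis mult.left_commute)
    have nrm: "(norm x)\<^sup>2 = Re (cinner x x)" for x :: "complex^'n"
      by (simp add: power2_norm_eq_inner inner_eq_Re_cinner)
    have ww: "w \<bullet> w = (cmod c\<^sub>1)\<^sup>2 * (norm x\<^sub>1)\<^sup>2 + (cmod c\<^sub>2)\<^sup>2 * (norm x\<^sub>2)\<^sup>2"
      unfolding inner_eq_Re_cinner w_def nrm
      by (simp add: cinner_add_left cinner_add_right cinner_scale_left cinner_scale_right orth orth' sq sq' del: times_complex.sel)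
    have Mw: "(M *v w) \<bullet> w = (cmod c\<^sub>1)\<^sup>2 * Re (cinner (M *v x\<^sub>1) x\<^sub>1) + (cmod c\<^sub>2)\<^sup>2 * Re (cinner (M *v x\<^sub>2) x\<^sub>2)"
      unfolding inner_eq_Re_cinner w_def
      by (simp add: matrix_vector_right_distrib vector_scalar_commute
          cinner_add_left cinner_add_right cinner_scale_left cinner_scale_right orth orth' sq sq' del: times_complex.sel)
    have "w \<bullet> w > 0"
    proof (cases "c\<^sub>1 = 0")
      case True
      then show ?thesis unfolding ww using c(2) nz by simp
    next
      case False
      then show ?thesis unfolding ww using nz by (intro add_pos_nonneg) auto
    qed
    then have w0: "w \<noteq> 0" by auto
    have wT: "w \<in> T"
    proof -
      have we: "cinner w e = 0" by (simp add: w_def cinner_add_left cinner_scale_left c)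
      have "w \<bullet> z = 0" if s: "s \<in> S" and z: "z \<in> ?E s" for s z
      proof -
        obtain k where "z = k *s e" using e [OF s] z by (auto simp: vec.span_singleton)
        then show ?thesis using we by (simp add: inner_eq_Re_cinner cinner_scale_right)
      qed
      then show ?thesis by (simp add: T_def)
    qed
    have "(M *v w) \<bullet> w \<ge> \<mu> * (w \<bullet> w)"
      unfolding ww Mw using mult_left_mono [OF ge(1), of "(cmod c\<^sub>1)\<^sup>2"] mult_left_mono [OF ge(2), of "(cmod c\<^sub>2)\<^sup>2"]
      by (simp add: algebra_simps)
    from self_adjoint_eigenvector_in_subspace [OF linear_matrix_vector_mult _ T MT wT w0 this]
    obtain v s where v: "v \<in> T" "v \<noteq> 0" "s \<ge> \<mu>" "M *v v = s *\<^sub>R v"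
      by (metis inner_eq_Re_cinner sa)
    then have "v \<in> ?E s" by (simp add: eigenspace_def scaleR_eq_of_real_scale)
    moreover from this have "s \<in> S" using v by (auto simp: S_def)
    ultimately have "v \<bullet> v = 0" using v(1) by (auto simp: T_def)
    then show False using v(2) by simp
  qed
  \<comment> \<open>The dimension count becomes a count of list entries: the part of the multiset
    over \<open>S\<close> survives the filter entirely, and the rest can only add to the
    size.\<close>
  let ?M = "\<Sum>s\<in>{s. ?E s \<noteq> {0}}. replicate_mset (vec.dim (?E s)) s"
  have "?M = (\<Sum>s\<in>{s. ?E s \<noteq> {0}} - S. replicate_mset (vec.dim (?E s)) s) +
      (\<Sum>s\<in>S. replicate_mset (vec.dim (?E s)) s)"
    using finite_eigenvalues [OF herm] by (intro sum.subset_diff) (auto simp: S_def)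
  then have "filter_mset (\<lambda>s. \<mu> \<le> s) ?M = filter_mset (\<lambda>s. \<mu> \<le> s) (\<Sum>s\<in>{s. ?E s \<noteq> {0}} - S. replicate_mset (vec.dim (?E s)) s) +
      filter_mset (\<lambda>s. \<mu> \<le> s) (\<Sum>s\<in>S. replicate_mset (vec.dim (?E s)) s)"
    by (simp only: filter_union_mset)
  moreover have "filter_mset (\<lambda>s. \<mu> \<le> s) (\<Sum>s\<in>S. replicate_mset (vec.dim (?E s)) s) =
      (\<Sum>s\<in>S. replicate_mset (vec.dim (?E s)) s)"
  proof -
    have "\<mu> \<le> t" if "t \<in># (\<Sum>s\<in>S. replicate_mset (vec.dim (?E s)) s)" for t
      using that fin by (auto simp: set_mset_sum S_def split: if_splits)
    then show ?thesis by (simp add: filter_mset_eq_conv)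
  qed
  ultimately have "size (filter_mset (\<lambda>s. \<mu> \<le> s) ?M) \<ge> (\<Sum>s\<in>S. vec.dim (?E s))"
    by (simp only: size_union size_multiset_sum size_replicate_mset le_add2)
  then have "size (filter_mset (\<lambda>s. \<mu> \<le> s) ?M) \<ge> 2"
    using two by linarith
  moreover have "length (filter (\<lambda>s. \<mu> \<le> s) (sorted_list_of_multiset ?M)) = size (filter_mset (\<lambda>s. \<mu> \<le> s) ?M)"
    by (simp only: size_mset [symmetric] mset_filter mset_sorted_list_of_multiset)
  ultimately have "length (filter (\<lambda>s. \<mu> \<le> s) (sorted_list_of_multiset ?M)) \<ge> 2"
    by (simp only:)
  from rev_sorted_nth_one_ge [OF sorted_sorted_list_of_multiset this]
  show ?thesis
    unfolding eigval_def eigenvalue_list_def by (simp only: numeral_2_eq_2 One_nat_def diff_Suc_Suc diff_zero)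
qed

section \<open>Walks and elementary inequalities\<close>

lemma walk_append:
  assumes "walk F ends u es v" "walk F ends v fs w"
  shows "walk F ends u (es @ fs) w"
  using assms by (induction rule: walk.induct) (auto intro: walk.intros)

lemma walk_rev:
  assumes "walk F ends u es v"
  shows "walk F ends v (rev es) u"
  using assms
proof (induction rule: walk.induct)
  case (Nil v)
  then show ?case by (simp add: walk.Nil)
next
  case (Cons e u v es w)
  then have "walk F ends v [e] u"
    by (intro walk.Cons [OF _ _ walk.Nil]) (auto simp: Upair_inject)
  then show ?case using Cons.IH by (simp add: walk_append)
qed

lemma graph_dist_le:
  assumes "walk F ends u es v"
  shows "graph_dist F ends u v \<le> enat (length es)"
  unfolding graph_dist_def using assms by (intro INF_lower) auto

text \<open>Cauchy--Schwarz in the plane for \<open>(sqrt x, sqrt x')\<close> and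
  \<open>(sqrt y, sqrt y')\<close>.\<close>

lemma sqrt_mult_superadditive:
  fixes x y x' y' :: real
  assumes "x \<ge> 0" "y \<ge> 0" "x' \<ge> 0" "y' \<ge> 0"
  shows "sqrt x * sqrt y + sqrt x' * sqrt y' \<le> sqrt (x + x') * sqrt (y + y')"
proof -
  have "2 * (sqrt x * sqrt y * (sqrt x' * sqrt y')) \<le> x * y' + x' * y"
    using sum_squares_bound [of "sqrt x * sqrt y'" "sqrt x' * sqrt y"] assms
    by (simp add: power_mult_distrib mult_ac)
  then have "(sqrt x * sqrt y + sqrt x' * sqrt y')\<^sup>2 \<le> (x + x') * (y + y')"
    using assms by (simp add: power2_sum power_mult_distrib algebra_simps)
  then show ?thesis
    by (metis real_le_rsqrt real_sqrt_mult)
qed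

text \<open>Read \<open>a n\<close> and \<open>b n\<close> as the numbers of tree vertices at
  distance \<open>n\<close> over the two ends of a skeleton edge that are entered across a lift of
  this edge. The left side sums the products over the tree edges above it; the right side is the
  product of the two fibre norms.\<close>

lemma sqrt_series_Cauchy_Schwarz:
  fixes a b :: "nat \<Rightarrow> real"
  assumes a: "\<And>n. a n \<ge> 0" and b: "\<And>n. b n \<ge> 0" and a0: "a 0 = b 0" and t: "t \<ge> 0"
  shows "a 0 + (\<Sum>n<m. t ^ (2 * n + 1) * (a (Suc n) + b (Suc n))) \<le>
    sqrt (\<Sum>n<Suc m. t ^ (2 * n) * (a n + b (Suc n))) *
    sqrt (\<Sum>n<Suc m. t ^ (2 * n) * (b n + a (Suc n)))"
proof -
  \<comment> \<open>\<open>P\<close> omits the vertices at the outermost distance whose edge leaves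
    the ball. Each remaining tree edge contributes one term to \<open>P a b m\<close> and one to
    \<open>P b a m\<close>.\<close>
  define P where "P = (\<lambda>c d m. c 0 + (\<Sum>n<m. t ^ (2 * Suc n) * c (Suc n) + t ^ (2 * n) * d (Suc n)))"
  have nonneg: "P c d m \<ge> 0" if "\<And>n. c n \<ge> 0" "\<And>n. d n \<ge> 0" for c d :: "nat \<Rightarrow> real" and m
    unfolding P_def using that t by (intro add_nonneg_nonneg sum_nonneg mult_nonneg_nonneg) auto
  have P: "P c d m \<le> (\<Sum>n<Suc m. t ^ (2 * n) * (c n + d (Suc n)))"
    if "\<And>n. c n \<ge> 0" "\<And>n. d n \<ge> 0" for c d :: "nat \<Rightarrow> real" and m
  proof -
    have "P c d m + t ^ (2 * m) * d (Suc m) = (\<Sum>n<Suc m. t ^ (2 * n) * (c n + d (Suc n)))"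
      by (induction m) (simp_all add: P_def algebra_simps)
    then show ?thesis using that(2) [of "Suc m"] t by (smt (verit) mult_nonneg_nonneg zero_le_power)
  qed
  have geo: "sqrt (t ^ (2 * Suc n) * x) * sqrt (t ^ (2 * n) * x) = t ^ (2 * n + 1) * x"
    if "x \<ge> 0" for n and x :: real
  proof -
    have "t ^ (2 * Suc n) * x * (t ^ (2 * n) * x) = (t ^ (2 * n + 1) * x)\<^sup>2"
      by (simp add: power2_eq_square power_add algebra_simps)
    then show ?thesis using that t by (simp flip: real_sqrt_mult)
  qed
  have "a 0 + (\<Sum>n<m. t ^ (2 * n + 1) * (a (Suc n) + b (Suc n))) \<le> sqrt (P a b m) * sqrt (P b a m)"
  proof (induction m)
    case 0
    then show ?case using a0 b [of 0] by (simp add: P_def)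
  next
    case (Suc m)
    let ?x = "t ^ (2 * Suc m) * a (Suc m)" and ?x' = "t ^ (2 * m) * a (Suc m)"
    let ?y = "t ^ (2 * Suc m) * b (Suc m)" and ?y' = "t ^ (2 * m) * b (Suc m)"
    have pos: "?x \<ge> 0" "?x' \<ge> 0" "?y \<ge> 0" "?y' \<ge> 0" using a b t by simp_all
    have "a 0 + (\<Sum>n<Suc m. t ^ (2 * n + 1) * (a (Suc n) + b (Suc n))) \<le>
        sqrt (P a b m) * sqrt (P b a m) + sqrt ?x * sqrt ?x' + sqrt ?y' * sqrt ?y"
      using Suc geo [OF a, of m "Suc m"] geo [OF b, of m "Suc m"]
      by (simp add: algebra_simps)
    also have "\<dots> \<le> sqrt (P a b m + ?x) * sqrt (P b a m + ?x') + sqrt ?y' * sqrt ?y"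
      using pos nonneg [OF a b] nonneg [OF b a] by (intro add_right_mono sqrt_mult_superadditive)
    also have "\<dots> \<le> sqrt (P a b m + ?x + ?y') * sqrt (P b a m + ?x' + ?y)"
      using pos nonneg [OF a b] nonneg [OF b a] by (intro sqrt_mult_superadditive add_nonneg_nonneg)
    also have "\<dots> = sqrt (P a b (Suc m)) * sqrt (P b a (Suc m))"
      by (simp add: P_def algebra_simps)
    finally show ?case .
  qed
  also have "\<dots> \<le> sqrt (\<Sum>n<Suc m. t ^ (2 * n) * (a n + b (Suc n))) *
      sqrt (\<Sum>n<Suc m. t ^ (2 * n) * (b n + a (Suc n)))"
    using order_trans [OF nonneg [of a b m, OF a b] P [of a b m, OF a b]] P [of a b m, OF a b]
      P [of b a m, OF b a] nonneg [of b a m, OF b a]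
    by (intro mult_mono real_sqrt_le_mono real_sqrt_ge_zero)
  finally show ?thesis .
qed

text \<open>Successive partial sums are related by the map taking \<open>S\<close> to
  \<open>1 - x * S\<close>, which preserves the unit interval.\<close>

lemma alternating_power_sum_bounds:
  fixes x :: real
  assumes "0 \<le> x" "x \<le> 1"
  shows "0 \<le> (\<Sum>n<m. (-x) ^ n) \<and> (\<Sum>n<m. (-x) ^ n) \<le> 1"
proof (induction m)
  case (Suc m)
  have "(\<Sum>n<Suc m. (-x) ^ n) = 1 - x * (\<Sum>n<m. (-x) ^ n)"
    by (subst sum.lessThan_Suc_shift) (simp add: sum_distrib_left sum_negf)
  moreover have "x * (\<Sum>n<m. (-x) ^ n) \<le> 1" "0 \<le> x * (\<Sum>n<m. (-x) ^ n)"
    using Suc assms by (simp_all add: mult_le_one)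
  ultimately show ?case by linarith
qed simp

section \<open>Radial functions pushed down from the tree\<close>

text \<open>The edge from \<open>u\<^sub>0\<close> to \<open>\<sigma> k u\<^sub>0\<close> is the
  centre. The universal cover is never constructed: its spheres enter as counts of non-backtracking
  walks.\<close>

locale skeleton_edge =
  fixes l :: nat and \<sigma> :: "nat \<Rightarrow> 'g::finite \<Rightarrow> 'g" and u\<^sub>0 :: 'g and k :: nat
  assumes bij: "i \<in> {1..l} \<Longrightarrow> bij (\<sigma> i)" and k: "k \<in> {1..l}"
begin

definition directions :: "(nat \<times> bool) set" where
  "directions = {1..l} \<times> UNIV"

fun step :: "nat \<times> bool \<Rightarrow> 'g \<Rightarrow> 'g" where
  "step (i, c) = (if c then \<sigma> i else inv (\<sigma> i))"

fun opposite :: "nat \<times> bool \<Rightarrow> nat \<times> bool" where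
  "opposite (i, c) = (i, \<not> c)"

text \<open>
  \<open>paths n s u\<close> counts the non-backtracking walks ending at \<open>u\<close> with last step in direction \<open>s\<close>
  that make \<open>n\<close> further steps after a first traversal, in either direction, of the edge
  \<open>(u\<^sub>0, k)\<close>. These are the vertices over \<open>u\<close> at distance \<open>n\<close> from a lift of that edge to the
  universal cover.
\<close>

fun paths :: "nat \<Rightarrow> nat \<times> bool \<Rightarrow> 'g \<Rightarrow> real" where
  "paths 0 (i, c) u = of_bool (i = k \<and> u = (if c then \<sigma> k u\<^sub>0 else u\<^sub>0))"
| "paths (Suc n) s u = (\<Sum>s'\<in>directions. paths n s' (step (opposite s) u)) -
     paths n (opposite s) (step (opposite s) u)"

definition level :: "nat \<Rightarrow> 'g \<Rightarrow> real" where
  "level n u = (\<Sum>s\<in>directions. paths n s u)"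

text \<open>The branching number \<open>d - 1\<close> of the tree, as
  \<open>d = 2 * l\<close>.\<close>

abbreviation (input) q :: real where "q \<equiv> 2 * real l - 1"

lemma finite_directions [simp]: "finite directions"
  by (simp add: directions_def)

lemma opposite_directions [simp]: "opposite s \<in> directions \<longleftrightarrow> s \<in> directions"
  by (cases s) (simp add: directions_def)

lemma fst_opposite [simp]: "fst (opposite s) = fst s"
  by (cases s) simp

lemma bij_step: "s \<in> directions \<Longrightarrow> bij (step s)"
  by (cases s) (auto simp: directions_def bij bij_imp_bij_inv)

lemma step_simps [simp]:
  assumes "i \<in> {1..l}"
  shows "\<sigma> i (inv (\<sigma> i) u) = u" "inv (\<sigma> i) (\<sigma> i u) = u"
  using bij [OF assms] by (simp_all add: bij_is_surj bij_is_inj surj_f_inv_f)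

text \<open>The backtracking count subtracted in the recursion is itself one of the
  summands.\<close>

lemma paths_nonneg: "s \<in> directions \<Longrightarrow> paths n s u \<ge> 0"
proof (induction n arbitrary: s u)
  case 0
  then show ?case by (cases s) simp
next
  case (Suc n)
  let ?u = "step (opposite s) u"
  have "paths n (opposite s) ?u \<le> (\<Sum>s'\<in>directions. paths n s' ?u)"
    using Suc by (intro member_le_sum) auto
  then show ?case by simp
qed

lemma level_nonneg: "level n u \<ge> 0"
  unfolding level_def by (intro sum_nonneg paths_nonneg)

text \<open>Each vertex of the tree over \<open>u\<close> lies on exactly one edge over \<open>(u, i)\<close>.\<close>

lemma level_eq:
  assumes "i \<in> {1..l}"
  shows "level n u = paths n (i, False) u + paths (Suc n) (i, True) (\<sigma> i u)"
    and "level n (\<sigma> i u) = paths n (i, True) (\<sigma> i u) + paths (Suc n) (i, False) u"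
  using assms by (simp_all add: level_def)

section \<open>Sizes of the spheres, split by direction\<close>

lemma l_pos: "real l \<ge> 1"
  using k by simp

lemma sum_directions: "(\<Sum>s\<in>directions. f (fst s)) = 2 * (\<Sum>i = 1..l. f i :: real)"
proof -
  have "(\<Sum>s\<in>directions. f (fst s)) = (\<Sum>i = 1..l. \<Sum>c\<in>(UNIV :: bool set). f i)"
    unfolding directions_def by (subst sum.cartesian_product) (simp add: case_prod_beta)
  then show ?thesis by (simp add: sum_distrib_left)
qed

text \<open>The first term is equidistribution, the second the deviation caused by starting on an
  edge of type \<open>k\<close>. Deviations cancel in the sum over all directions, so only the
  subtracted backtracking term passes them on, with the sign flipped.\<close>

lemma sum_paths:
  assumes "s \<in> directions"
  shows "(\<Sum>u\<in>UNIV. paths n s u) = q ^ n / l + (-1) ^ n * (of_bool (fst s = k) - 1 / l)"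
  using assms
proof (induction n arbitrary: s)
  case 0
  then show ?case by (cases s) (auto simp: of_bool_def)
next
  case (Suc n)
  have "(\<Sum>u\<in>UNIV. paths (Suc n) s u) =
      (\<Sum>u\<in>UNIV. (\<Sum>s'\<in>directions. paths n s' u) - paths n (opposite s) u)"
    using sum.reindex_bij_betw [OF bij_step [of "opposite s"],
        of "\<lambda>u. (\<Sum>s'\<in>directions. paths n s' u) - paths n (opposite s) u"] Suc.prems by simp
  also have "\<dots> = (\<Sum>s'\<in>directions. \<Sum>u\<in>UNIV. paths n s' u) - (\<Sum>u\<in>UNIV. paths n (opposite s) u)"
    by (simp add: sum_subtractf) (rule sum.swap)
  also have "(\<Sum>s'\<in>directions. \<Sum>u\<in>UNIV. paths n s' u) =
      (\<Sum>s'\<in>directions. q ^ n / l + (-1) ^ n * (of_bool (fst s' = k) - 1 / l))"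
    using Suc.IH by simp
  also have "\<dots> = 2 * (\<Sum>i = 1..l. q ^ n / l + (-1) ^ n * (of_bool (i = k) - 1 / l))"
    by (rule sum_directions)
  also have "(\<Sum>i = 1..l. q ^ n / l + (-1) ^ n * (of_bool (i = k) - 1 / l)) = q ^ n"
    using k l_pos by (simp add: sum.distrib sum_subtractf flip: sum_distrib_left)
  also have "(\<Sum>u\<in>UNIV. paths n (opposite s) u) = q ^ n / l + (-1) ^ n * (of_bool (fst s = k) - 1 / l)"
    using Suc.IH [of "opposite s"] Suc.prems by simp
  \<comment> \<open>Since \<open>2 - 1 / l = q / l\<close>, the uniform part grows by the factor
    \<open>q\<close>.\<close>
  also have "2 * X - (X / l + e * D) = q * X / l + - e * D" for X e D
    using l_pos by (simp add: field_simps)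
  finally show ?case by (simp only: power_Suc mult_minus1)
qed

lemma sum_level: "(\<Sum>u\<in>UNIV. level n u) = 2 * q ^ n"
proof -
  have "(\<Sum>u\<in>UNIV. level n u) = (\<Sum>s\<in>directions. \<Sum>u\<in>UNIV. paths n s u)"
    unfolding level_def by (rule sum.swap)
  also have "\<dots> = (\<Sum>s\<in>directions. q ^ n / l + (-1) ^ n * (of_bool (fst s = k) - 1 / l))"
    by (simp add: sum_paths)
  also have "\<dots> = 2 * (\<Sum>i = 1..l. q ^ n / l + (-1) ^ n * (of_bool (i = k) - 1 / l))"
    by (rule sum_directions)
  also have "(\<Sum>i = 1..l. q ^ n / l + (-1) ^ n * (of_bool (i = k) - 1 / l)) = q ^ n"
    using k l_pos by (simp add: sum.distrib sum_subtractf flip: sum_distrib_left)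
  finally show ?thesis .
qed

text \<open>The square of \<open>t ^ n\<close> decays exactly as fast as the spheres grow.\<close>

definition t :: real where "t = 1 / sqrt q"

text \<open>The norm over the fibre of \<open>u\<close> of the radial function \<open>t ^ n\<close> on the tree.\<close>

definition radial :: "nat \<Rightarrow> 'g \<Rightarrow> real" where
  "radial r u = sqrt (\<Sum>n<r. t ^ (2 * n) * level n u)"

lemma t_pos: "t > 0" and t_le_1: "t \<le> 1" and t_q: "t\<^sup>2 * q = 1" "t * q = sqrt q"
  using l_pos by (auto simp: t_def power_divide real_div_sqrt)

text \<open>As \<open>t\<^sup>2 * q = 1\<close>, each of the \<open>r\<close> spheres carries the
  same mass 2.\<close>

lemma sum_radial_sq: "(\<Sum>u\<in>UNIV. (radial r u)\<^sup>2) = 2 * real r"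
proof -
  have "(radial r u)\<^sup>2 = (\<Sum>n<r. t ^ (2 * n) * level n u)" for u
    unfolding radial_def using level_nonneg t_pos by (intro real_sqrt_pow2 sum_nonneg) auto
  then have "(\<Sum>u\<in>UNIV. (radial r u)\<^sup>2) = (\<Sum>n<r. t ^ (2 * n) * (\<Sum>u\<in>UNIV. level n u))"
    by (simp add: sum_distrib_left) (rule sum.swap)
  also have "\<dots> = (\<Sum>n<r. 2 * (t\<^sup>2 * q) ^ n)"
  proof (rule sum.cong [OF refl])
    show "t ^ (2 * n) * (\<Sum>u\<in>UNIV. level n u) = 2 * (t\<^sup>2 * q) ^ n" for n
      unfolding sum_level by (simp add: power_mult_distrib flip: power_mult)
  qed
  also have "\<dots> = 2 * real r" unfolding t_q by simp
  finally show ?thesis .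
qed

section \<open>Lower bounds for the edge sums of the radial function\<close>

lemma radial_edge_ge:
  assumes i: "i \<in> {1..l}"
  shows "radial (Suc m) u * radial (Suc m) (\<sigma> i u) \<ge> paths 0 (i, False) u +
    (\<Sum>n<m. t ^ (2 * n + 1) * (paths (Suc n) (i, False) u + paths (Suc n) (i, True) (\<sigma> i u)))"
proof -
  have dir: "(i, c) \<in> directions" for c using i by (simp add: directions_def)
  \<comment> \<open>The central edge must count equally from both ends: for \<open>i = k\<close>
    this is injectivity, otherwise both counts are 0.\<close>
  have "inj (\<sigma> k)" using bij [OF k] by (rule bij_is_inj)
  then have "paths 0 (i, False) u = paths 0 (i, True) (\<sigma> i u)"
    by (auto simp: inj_eq)
  from sqrt_series_Cauchy_Schwarz [of "\<lambda>n. paths n (i, False) u" "\<lambda>n. paths n (i, True) (\<sigma> i u)",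
      OF paths_nonneg [OF dir] paths_nonneg [OF dir] this less_imp_le [OF t_pos]]
  show ?thesis unfolding radial_def level_eq(1) [OF i, of _ u] level_eq(2) [OF i] .
qed

text \<open>Around the central edge lie \<open>m\<close> layers of edges. Each has the same main
  term, because \<open>t ^ (2 * n + 1) * q ^ Suc n = sqrt q\<close>, while the deviations form an
  alternating geometric series.\<close>

lemma sum_radial_edge_ge:
  assumes i: "i \<in> {1..l}"
  shows "(\<Sum>u\<in>UNIV. radial (Suc m) u * radial (Suc m) (\<sigma> i u)) \<ge> of_bool (i = k) +
    2 * (real m * sqrt q / l - t * (\<Sum>n<m. (- (t\<^sup>2)) ^ n) * (of_bool (i = k) - 1 / l))"
proof -
  have dir: "(i, c) \<in> directions" for c using i by (simp add: directions_def)
  let ?D = "of_bool (i = k) - 1 / real l"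
  have "(\<Sum>u\<in>UNIV. paths 0 (i, False) u) = of_bool (i = k)"
    unfolding sum_paths [OF dir] by simp
  moreover have "(\<Sum>u\<in>UNIV. paths n (i, True) (\<sigma> i u)) = (\<Sum>u\<in>UNIV. paths n (i, True) u)" for n
    using sum.reindex_bij_betw [OF bij [OF i]] .
  ultimately have "(\<Sum>u\<in>UNIV. paths 0 (i, False) u +
      (\<Sum>n<m. t ^ (2 * n + 1) * (paths (Suc n) (i, False) u + paths (Suc n) (i, True) (\<sigma> i u)))) =
      of_bool (i = k) + (\<Sum>n<m. t ^ (2 * n + 1) * (2 * (q ^ Suc n / l + (-1) ^ Suc n * ?D)))"
    using sum.swap [of "\<lambda>u n. t ^ (2 * n + 1) * (paths (Suc n) (i, False) u + paths (Suc n) (i, True) (\<sigma> i u))" "{..<m}" UNIV]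
    by (simp only: sum.distrib sum_distrib_left [symmetric] sum_paths [OF dir] fst_conv mult_2)
  also have "(\<Sum>n<m. t ^ (2 * n + 1) * (2 * (q ^ Suc n / l + (-1) ^ Suc n * ?D))) =
      (\<Sum>n<m. 2 * (sqrt q / l - t * (- (t\<^sup>2)) ^ n * ?D))"
  proof (rule sum.cong [OF refl])
    fix n
    have "t ^ (2 * n + 1) * q ^ Suc n = (t\<^sup>2 * q) ^ n * (t * q)"
      by (simp add: power_mult power_mult_distrib)
    then have 1: "t ^ (2 * n + 1) * q ^ Suc n = sqrt q" unfolding t_q by simp
    have 2: "t ^ (2 * n + 1) * (-1) ^ Suc n = - (t * (- (t\<^sup>2)) ^ n)"
      by (simp add: power_mult power_minus [of "t\<^sup>2"])
    have "t ^ (2 * n + 1) * (2 * (q ^ Suc n / l + (-1) ^ Suc n * ?D)) =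
        2 * (t ^ (2 * n + 1) * q ^ Suc n / l + t ^ (2 * n + 1) * (-1) ^ Suc n * ?D)"
      by (simp only: algebra_simps times_divide_eq_right)
    then show "t ^ (2 * n + 1) * (2 * (q ^ Suc n / l + (-1) ^ Suc n * ?D)) =
        2 * (sqrt q / l - t * (- (t\<^sup>2)) ^ n * ?D)"
      unfolding 1 2 by simp
  qed
  also have "\<dots> = 2 * (real m * sqrt q / l - t * (\<Sum>n<m. (- (t\<^sup>2)) ^ n) * ?D)"
    by (simp add: sum_subtractf sum_distrib_left sum_distrib_right)
  finally have "(\<Sum>u\<in>UNIV. paths 0 (i, False) u +
      (\<Sum>n<m. t ^ (2 * n + 1) * (paths (Suc n) (i, False) u + paths (Suc n) (i, True) (\<sigma> i u)))) =
      of_bool (i = k) + 2 * (real m * sqrt q / l - t * (\<Sum>n<m. (- (t\<^sup>2)) ^ n) * ?D)" .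
  moreover have "(\<Sum>u\<in>UNIV. paths 0 (i, False) u +
      (\<Sum>n<m. t ^ (2 * n + 1) * (paths (Suc n) (i, False) u + paths (Suc n) (i, True) (\<sigma> i u)))) \<le>
      (\<Sum>u\<in>UNIV. radial (Suc m) u * radial (Suc m) (\<sigma> i u))"
    by (intro sum_mono radial_edge_ge i)
  ultimately show ?thesis by (simp only:)
qed

text \<open>Having \<open>r - 1\<close> layers between \<open>r\<close> spheres costs
  \<open>2 * sqrt q * \<mu>\<close>, and the central edge gives back \<open>\<alpha> k\<close>. The
  weights must be non-negative for the bounds on single edge types to add up.\<close>

lemma weighted_radial_edge_sum_ge:
  fixes \<alpha> :: "nat \<Rightarrow> real"
  assumes \<alpha>: "\<And>i. i \<in> {1..l} \<Longrightarrow> \<alpha> i \<ge> 0" and mean: "\<mu> = (\<Sum>i = 1..l. \<alpha> i) / l" and r: "r \<ge> 1"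
  shows "(\<Sum>i = 1..l. \<alpha> i * (\<Sum>u\<in>UNIV. radial r u * radial r (\<sigma> i u))) \<ge>
    2 * real r * sqrt q * \<mu> - ((2 * sqrt q - 1) * \<mu> + \<bar>\<mu> - \<alpha> k\<bar>)"
proof -
  obtain m where m: "r = Suc m" using r by (cases r) auto
  define S where "S = t * (\<Sum>n<m. (- (t\<^sup>2)) ^ n)"
  have "t\<^sup>2 \<le> 1" using t_pos t_le_1 by (simp add: power_le_one)
  from alternating_power_sum_bounds [OF _ this, of m]
  have S: "0 \<le> S" "S \<le> 1" using t_pos t_le_1 by (auto simp: S_def mult_le_one)
  have sum_k: "(\<Sum>i = 1..l. \<alpha> i * of_bool (i = k)) = \<alpha> k"
    using k by (simp add: of_bool_def if_distrib cong: if_cong)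
  have "(\<Sum>i = 1..l. \<alpha> i * (of_bool (i = k) + 2 * (real m * sqrt q / l - S * (of_bool (i = k) - 1 / l)))) =
      (\<Sum>i = 1..l. (1 - 2 * S) * (\<alpha> i * of_bool (i = k)) + (2 * (real m * sqrt q) + 2 * S) * (\<alpha> i / l))"
    by (rule sum.cong) (use l_pos in \<open>auto simp: field_simps\<close>)
  also have "\<dots> = (1 - 2 * S) * \<alpha> k + (2 * (real m * sqrt q) + 2 * S) * \<mu>"
    by (simp only: sum.distrib sum_distrib_left [symmetric] sum_k mean sum_divide_distrib [symmetric])
  also have "\<dots> = 2 * real r * sqrt q * \<mu> - ((2 * sqrt q - 1) * \<mu> + (1 - 2 * S) * (\<mu> - \<alpha> k))"
    by (simp add: m algebra_simps)
  finally have eq: "(\<Sum>i = 1..l. \<alpha> i * (of_bool (i = k) + 2 * (real m * sqrt q / l - S * (of_bool (i = k) - 1 / l)))) = \<dots>" .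
  have "(\<Sum>i = 1..l. \<alpha> i * (of_bool (i = k) + 2 * (real m * sqrt q / l - S * (of_bool (i = k) - 1 / l)))) \<le>
      (\<Sum>i = 1..l. \<alpha> i * (\<Sum>u\<in>UNIV. radial r u * radial r (\<sigma> i u)))"
    unfolding m S_def by (intro sum_mono mult_left_mono sum_radial_edge_ge \<alpha>)
  then have ge: "2 * real r * sqrt q * \<mu> - ((2 * sqrt q - 1) * \<mu> + (1 - 2 * S) * (\<mu> - \<alpha> k)) \<le>
      (\<Sum>i = 1..l. \<alpha> i * (\<Sum>u\<in>UNIV. radial r u * radial r (\<sigma> i u)))"
    unfolding eq .
  \<comment> \<open>As \<open>S\<close> lies in the unit interval, \<open>1 - 2 * S\<close> is at
    most 1 in absolute value; this produces the absolute value in the constant.\<close>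
  have "(1 - 2 * S) * (\<mu> - \<alpha> k) \<le> \<bar>1 - 2 * S\<bar> * \<bar>\<mu> - \<alpha> k\<bar>"
    by (metis abs_ge_self abs_mult)
  also have "\<dots> \<le> 1 * \<bar>\<mu> - \<alpha> k\<bar>"
    using S by (intro mult_right_mono) auto
  finally have "(1 - 2 * S) * (\<mu> - \<alpha> k) \<le> \<bar>\<mu> - \<alpha> k\<bar>" by simp
  then show ?thesis
    using ge by (meson add_left_mono diff_left_mono order_trans)
qed

section \<open>Supports of the radial functions\<close>

lemma skel_walk_step:
  assumes "s \<in> directions"
  shows "\<exists>e. walk (skel_edges l) (skel_ends \<sigma>) u [e] (step s u)"
proof (cases s)
  case (Pair i c)
  have "walk (skel_edges l) (skel_ends \<sigma>) u [(if c then u else inv (\<sigma> i) u, i)] (step s u)"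
    using assms Pair
    by (intro walk.Cons [OF _ _ walk.Nil]) (auto simp: directions_def skel_edges_def Upair_inject)
  then show ?thesis ..
qed

lemma paths_walk:
  assumes "s \<in> directions" "paths n s u \<noteq> 0"
  shows "\<exists>es. \<exists>w\<in>set_uprod (skel_ends \<sigma> (u\<^sub>0, k)). walk (skel_edges l) (skel_ends \<sigma>) u es w \<and> length es = n"
  using assms
proof (induction n arbitrary: s u)
  case 0
  then have "u \<in> set_uprod (skel_ends \<sigma> (u\<^sub>0, k))" by (cases s) (auto split: if_splits)
  then show ?case using walk.Nil by fastforce
next
  case (Suc n)
  let ?v = "step (opposite s) u"
  have opp: "opposite s \<in> directions" using Suc.prems by simp
  have "\<exists>s'\<in>directions. paths n s' ?v \<noteq> 0"
  proof (rule ccontr)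
    assume *: "\<not> (\<exists>s'\<in>directions. paths n s' ?v \<noteq> 0)"
    then have "paths (Suc n) s u = 0" using opp by simp
    then show False using Suc.prems by simp
  qed
  then obtain es w where w: "w \<in> set_uprod (skel_ends \<sigma> (u\<^sub>0, k))"
    and es: "walk (skel_edges l) (skel_ends \<sigma>) ?v es w" "length es = n"
    using Suc.IH by blast
  obtain e where "walk (skel_edges l) (skel_ends \<sigma>) u [e] ?v"
    using skel_walk_step [OF opp] by blast
  from walk_append [OF this es(1)] show ?case using w es(2) by (intro exI [of _ "e # es"]) auto
qed

text \<open>This confinement to distance at most \<open>r - 1\<close> from the central edge keeps
  the two test functions apart.\<close>

lemma radial_walk:
  assumes "radial r u \<noteq> 0"
  shows "\<exists>es. \<exists>w\<in>set_uprod (skel_ends \<sigma> (u\<^sub>0, k)). walk (skel_edges l) (skel_ends \<sigma>) u es w \<and> length es < r"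
proof -
  have "\<exists>n<r. level n u \<noteq> 0"
    using assms by (auto simp: radial_def intro: ccontr)
  then obtain n where n: "n < r" "level n u \<noteq> 0" by blast
  then obtain s where "s \<in> directions" "paths n s u \<noteq> 0"
    unfolding level_def by (meson sum.neutral)
  then show ?thesis using paths_walk n(1) by blast
qed

end

section \<open>Quadratic forms on blocks\<close>

lemma ctranspose_jacobi_on: "ctranspose (jacobi_on F ends a b) = jacobi_on F ends a b"
proof -
  have "Upair v w = Upair w v" for v w :: 'v by (simp add: Upair_inject)
  then show ?thesis
    unfolding ctranspose_def jacobi_on_def vec_eq_iff by (auto intro!: sum.cong)
qed

lemma sum_matrix_vector_mult:
  fixes M :: "'i \<Rightarrow> complex^'n^'m"
  shows "sum M S *v x = (\<Sum>i\<in>S. M i *v x)"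
  by (induction S rule: infinite_finite_induct) (simp_all add: matrix_vector_mult_add_rdistrib)

lemma cinner_ctranspose_self: "cinner (ctranspose M *v x) x = cnj (cinner (M *v x) x)"
  by (simp add: cinner_ctranspose [of M] cnj_cinner)

text \<open>The form is \<open>c\<close> times a product of two entries of \<open>y\<close>. Here
  the sign condition on \<open>y\<close> enters; it supplies the non-negative weights for the edge
  sums.\<close>

lemma Re_cinner_elementary_matrix_nonneg:
  fixes y :: "complex^'n"
  assumes "c \<ge> 0" and y: "\<And>v. y $ v \<in> \<real>\<^sub>\<ge>\<^sub>0"
  shows "Re (cinner (elementary_matrix s t c *v y) y) \<ge> 0"
proof -
  have "Re ((elementary_matrix s t c *v y) $ v * cnj (y $ v)) \<ge> 0" for v
    using assms(1) y [of v] y [of t]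
    by (auto simp: elementary_matrix_mult complex_nonneg_Reals_iff)
  then show ?thesis by (simp add: cinner_def sum_nonneg del: times_complex.sel)
qed

text \<open>\<open>to_blocks\<close> merely relabels coordinates along a bijection, hence is
  unitary.\<close>

lemma cinner_to_blocks:
  fixes \<phi> :: "'g::finite \<Rightarrow> 'v::finite \<Rightarrow> 'x::finite"
  assumes "bij (\<lambda>(u, v). \<phi> u v)"
  shows "cinner x z = (\<Sum>u\<in>UNIV. cinner (to_blocks \<phi> x $ u) (to_blocks \<phi> z $ u))"
proof -
  have "cinner x z = (\<Sum>(u, v)\<in>UNIV. x $ \<phi> u v * cnj (z $ \<phi> u v))"
    unfolding cinner_def
    by (subst sum.reindex_bij_betw [OF assms, symmetric]) (simp add: case_prod_beta)
  then show ?thesis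
    unfolding UNIV_Times_UNIV [symmetric] sum.cartesian_product [symmetric]
    by (simp add: cinner_def to_blocks_def)
qed

text \<open>On product vectors the form splits into scalar sums over the skeleton times forms of the
  blocks. Reindexing by \<open>\<sigma> i\<close> removes its inverse.\<close>

lemma cinner_block_operator:
  fixes \<sigma> :: "nat \<Rightarrow> 'g::finite \<Rightarrow> 'g" and y :: "complex^'v"
  assumes bij: "\<And>i. i \<in> {1..l} \<Longrightarrow> bij (\<sigma> i)"
  shows "(\<Sum>u\<in>UNIV. cinner (block_operator l B A \<sigma> (\<chi> u. of_real (F u) *s y) $ u) (of_real (G u) *s y)) =
    of_real (\<Sum>u\<in>UNIV. F u * G u) * cinner (B *v y) y +
    (\<Sum>i = 1..l. of_real (\<Sum>u\<in>UNIV. F (\<sigma> i u) * G u) * cinner (A i *v y) y +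
       of_real (\<Sum>u\<in>UNIV. F u * G (\<sigma> i u)) * cnj (cinner (A i *v y) y))"
proof -
  let ?c = "\<lambda>i. cinner (A i *v y) y"
  have inv: "(\<Sum>u\<in>UNIV. F (inv (\<sigma> i) u) * G u) = (\<Sum>u\<in>UNIV. F u * G (\<sigma> i u))" if "i \<in> {1..l}" for i
    using sum.reindex_bij_betw [OF bij [OF that], of "\<lambda>u. F (inv (\<sigma> i) u) * G u"]
    by (simp add: inv_f_f [OF bij_is_inj [OF bij [OF that]]])
  have "(\<Sum>u\<in>UNIV. cinner (block_operator l B A \<sigma> (\<chi> u. of_real (F u) *s y) $ u) (of_real (G u) *s y)) =
      (\<Sum>u\<in>UNIV. of_real (F u * G u) * cinner (B *v y) y +
        (\<Sum>i = 1..l. of_real (F (\<sigma> i u) * G u) * ?c i + of_real (F (inv (\<sigma> i) u) * G u) * cnj (?c i)))"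
    by (rule sum.cong)
      (simp_all add: block_operator_def cinner_add_left cinner_sum_left cinner_scale_left cinner_scale_right
        vector_scalar_commute cinner_ctranspose_self sum_distrib_left algebra_simps)
  also have "\<dots> = of_real (\<Sum>u\<in>UNIV. F u * G u) * cinner (B *v y) y +
      (\<Sum>i = 1..l. of_real (\<Sum>u\<in>UNIV. F (\<sigma> i u) * G u) * ?c i +
        of_real (\<Sum>u\<in>UNIV. F (inv (\<sigma> i) u) * G u) * cnj (?c i))"
    unfolding of_real_sum sum_distrib_right sum.distrib
    by (simp only: sum.swap [of _ "{1..l}" UNIV])
  finally show ?thesis using inv by simp
qed

theorem theorem1p2:
  fixes ends\<^sub>0 :: "'e::finite \<Rightarrow> 'v::finite uprod"
    and a :: "'e \<Rightarrow> real" and b :: "'v \<Rightarrow> real"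
    and l d r j :: nat
    and ed :: "nat \<Rightarrow> 'e" and ini ter :: "nat \<Rightarrow> 'v"
    and B :: "complex^'v^'v" and A :: "nat \<Rightarrow> complex^'v^'v" and Asum :: "complex^'v^'v"
    and ends :: "'y::finite \<Rightarrow> 'x::finite uprod"
    and \<pi>V :: "'x \<Rightarrow> 'v" and \<pi>E :: "'y \<Rightarrow> 'e"
    and J :: "complex^'x^'x"
    and \<sigma> :: "nat \<Rightarrow> 'g::finite \<Rightarrow> 'g"
    and \<phi> :: "'g \<Rightarrow> 'v \<Rightarrow> 'x" and \<psi> :: "'g \<Rightarrow> 'e \<Rightarrow> 'y"
    and \<epsilon>\<^sub>1 \<epsilon>\<^sub>2 :: "'g \<times> nat"
    and y :: "complex^'v"
    and C :: real
  assumes "connected_graph UNIV ends\<^sub>0"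
    and "\<And>v. vertex_degree ends\<^sub>0 v \<noteq> 1"
    and "\<And>e. a e > 0"
    and "l = betti ends\<^sub>0" and "d = 2 * l"
    and "inj_on ed {1..l}"
    and "tree_graph (- ed ` {1..l}) ends\<^sub>0"
    and "\<And>i. i \<in> {1..l} \<Longrightarrow> ends\<^sub>0 (ed i) = Upair (ini i) (ter i)"
    and "B = jacobi_on (- ed ` {1..l}) ends\<^sub>0 a b"
    and "\<And>i. A i = elementary_matrix (ini i) (ter i) (a (ed i))"
    and "Asum = (\<Sum>i = 1..l. A i + ctranspose (A i))"
    and "graph_covering ends \<pi>V \<pi>E ends\<^sub>0"
    and "J = jacobi ends (a \<circ> \<pi>E) (b \<circ> \<pi>V)"
    and "skeleton_of_cover ends\<^sub>0 l ed ini ter ends \<pi>V \<pi>E \<sigma> \<phi> \<psi>"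
    and "r \<ge> 1"
    and "j \<in> {1..l}"
    and "\<epsilon>\<^sub>1 \<in> skel_edges l" and "A (snd \<epsilon>\<^sub>1) \<in> {A j, ctranspose (A j)}"
    and "\<epsilon>\<^sub>2 \<in> skel_edges l" and "A (snd \<epsilon>\<^sub>2) \<in> {A j, ctranspose (A j)}"
    and "\<And>u v. u \<in> set_uprod (skel_ends \<sigma> \<epsilon>\<^sub>1) \<Longrightarrow> v \<in> set_uprod (skel_ends \<sigma> \<epsilon>\<^sub>2) \<Longrightarrow>
           graph_dist (skel_edges l) (skel_ends \<sigma>) u v > enat (2 * r + 2)"
    and "norm y = 1" and "\<And>v. y $ v \<in> \<real>\<^sub>\<ge>\<^sub>0"
    and "C = (2 * sqrt (real d - 1) - 1) * (Re (cinner (Asum *v y) y) / real d)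
             + \<bar>Re (cinner (Asum *v y) y) / real d - Re (cinner (A j *v y) y)\<bar>"
  shows "eigval 2 J \<ge> Re (cinner (B *v y) y)
           + 2 * sqrt (real d - 1) * (Re (cinner (Asum *v y) y) / real d) - C / real r"
proof -
  note a_pos = assms(3) and d = assms(5) and inj = assms(6) and dir = assms(8)
    and B = assms(9) and A = assms(10) and Asum = assms(11) and J = assms(13) and skel = assms(14)
    and r = assms(15) and far = assms(21) and y = assms(22) and y_nonneg = assms(23)
    and C = assms(24)
  define \<alpha> where "\<alpha> = (\<lambda>i. Re (cinner (A i *v y) y))"
  define \<beta> where "\<beta> = Re (cinner (B *v y) y)"
  define m where "m = (\<Sum>i = 1..l. \<alpha> i) / real l"
  define \<mu> where "\<mu> = \<beta> + 2 * sqrt (real d - 1) * m - C / real r"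
  \<comment> \<open>\<open>A i\<close> and its adjoint have the same real form, so the factor 2 in
    the numerator cancels that of \<open>d = 2 * l\<close>.\<close>
  have mean: "Re (cinner (Asum *v y) y) / real d = m"
    unfolding Asum m_def \<alpha>_def d
    by (simp add: sum_matrix_vector_mult matrix_vector_mult_add_rdistrib cinner_sum_left cinner_add_left
        cinner_ctranspose_self sum.distrib)
  have \<alpha>_nonneg: "\<alpha> i \<ge> 0" for i
    unfolding \<alpha>_def A using a_pos y_nonneg by (intro Re_cinner_elementary_matrix_nonneg less_imp_le)
  have bij: "bij (\<sigma> i)" if "i \<in> {1..l}" for i
    using skel that by (simp add: skeleton_of_cover_def)
  have \<phi>: "bij (\<lambda>(u, v). \<phi> u v)"
    using skel by (simp add: skeleton_of_cover_def)
  have q: "real d - 1 = 2 * real l - 1" by (simp add: d)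

  have test: "\<exists>F. (\<Sum>u\<in>UNIV. (F u)\<^sup>2) = 2 * real r \<and>
      (\<Sum>i = 1..l. \<alpha> i * (\<Sum>u\<in>UNIV. F u * F (\<sigma> i u))) \<ge> 2 * real r * sqrt (real d - 1) * m - C \<and>
      (\<forall>u. F u \<noteq> 0 \<longrightarrow> (\<exists>es. \<exists>w\<in>set_uprod (skel_ends \<sigma> \<epsilon>).
         walk (skel_edges l) (skel_ends \<sigma>) u es w \<and> length es < r))"
    if "\<epsilon> \<in> skel_edges l" "A (snd \<epsilon>) \<in> {A j, ctranspose (A j)}" for \<epsilon>
  proof -
    obtain u k where \<epsilon>: "\<epsilon> = (u, k)" by fastforce
    interpret skeleton_edge l \<sigma> u k
      using bij that(1) by unfold_locales (auto simp: \<epsilon> skel_edges_def)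
    \<comment> \<open>The index \<open>k\<close> of the given edge may differ from \<open>j\<close>;
      equality of the matrices up to adjoint is enough to fix the constant.\<close>
    have "\<alpha> k = \<alpha> j"
      using that(2) by (auto simp: \<alpha>_def \<epsilon> cinner_ctranspose_self)
    then have "C = (2 * sqrt (2 * real l - 1) - 1) * m + \<bar>m - \<alpha> k\<bar>"
      unfolding C mean by (simp add: q \<alpha>_def)
    then show ?thesis
      using sum_radial_sq [of r] weighted_radial_edge_sum_ge [OF \<alpha>_nonneg m_def r] radial_walk [of r]
      unfolding \<epsilon> q by (intro exI [of _ "radial r"]) simp
  qed
  obtain F\<^sub>1 where F\<^sub>1: "(\<Sum>u\<in>UNIV. (F\<^sub>1 u)\<^sup>2) = 2 * real r"
      "(\<Sum>i = 1..l. \<alpha> i * (\<Sum>u\<in>UNIV. F\<^sub>1 u * F\<^sub>1 (\<sigma> i u))) \<ge> 2 * real r * sqrt (real d - 1) * m - C"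
      "\<And>u. F\<^sub>1 u \<noteq> 0 \<Longrightarrow> \<exists>es. \<exists>w\<in>set_uprod (skel_ends \<sigma> \<epsilon>\<^sub>1).
         walk (skel_edges l) (skel_ends \<sigma>) u es w \<and> length es < r"
    using test [OF assms(17,18)] by blast
  obtain F\<^sub>2 where F\<^sub>2: "(\<Sum>u\<in>UNIV. (F\<^sub>2 u)\<^sup>2) = 2 * real r"
      "(\<Sum>i = 1..l. \<alpha> i * (\<Sum>u\<in>UNIV. F\<^sub>2 u * F\<^sub>2 (\<sigma> i u))) \<ge> 2 * real r * sqrt (real d - 1) * m - C"
      "\<And>u. F\<^sub>2 u \<noteq> 0 \<Longrightarrow> \<exists>es. \<exists>w\<in>set_uprod (skel_ends \<sigma> \<epsilon>\<^sub>2).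
         walk (skel_edges l) (skel_ends \<sigma>) u es w \<and> length es < r"
    using test [OF assms(19,20)] by blast

  \<comment> \<open>Length 0 excludes a common vertex, length 1 adjacency. The concatenated walk has
    at most \<open>2 * r - 1\<close> steps.\<close>
  have no_walk: False
    if u: "F\<^sub>1 u \<noteq> 0" and v: "F\<^sub>2 v \<noteq> 0" and es: "walk (skel_edges l) (skel_ends \<sigma>) u es v" "length es \<le> 1" for u v es
  proof -
    obtain w\<^sub>1 es\<^sub>1 where 1: "w\<^sub>1 \<in> set_uprod (skel_ends \<sigma> \<epsilon>\<^sub>1)"
        "walk (skel_edges l) (skel_ends \<sigma>) u es\<^sub>1 w\<^sub>1" "length es\<^sub>1 < r"
      using F\<^sub>1(3) [OF u] by blast
    obtain w\<^sub>2 es\<^sub>2 where 2: "w\<^sub>2 \<in> set_uprod (skel_ends \<sigma> \<epsilon>\<^sub>2)"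
        "walk (skel_edges l) (skel_ends \<sigma>) v es\<^sub>2 w\<^sub>2" "length es\<^sub>2 < r"
      using F\<^sub>2(3) [OF v] by blast
    have "walk (skel_edges l) (skel_ends \<sigma>) w\<^sub>1 (rev es\<^sub>1 @ es @ es\<^sub>2) w\<^sub>2"
      using 1(2) 2(2) es(1) by (intro walk_append walk_rev)
    from graph_dist_le [OF this] far [OF 1(1) 2(1)]
    have "enat (2 * r + 2) < enat (length (rev es\<^sub>1 @ es @ es\<^sub>2))" by (rule less_le_trans [rotated])
    then show False using 1(3) 2(3) es(2) by simp
  qed
  have disj: "F\<^sub>1 u * F\<^sub>2 u = 0" for u
    using no_walk [of u u "[]"] walk.Nil by force
  have edge: "walk (skel_edges l) (skel_ends \<sigma>) u [(u, i)] (\<sigma> i u)" if "i \<in> {1..l}" for u i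
    using that by (intro walk.Cons [OF _ _ walk.Nil]) (auto simp: skel_edges_def)
  have sep: "F\<^sub>1 (\<sigma> i u) * F\<^sub>2 u = 0" "F\<^sub>1 u * F\<^sub>2 (\<sigma> i u) = 0" if "i \<in> {1..l}" for i u
    using no_walk [OF _ _ edge [OF that, of u]] no_walk [OF _ _ walk_rev [OF edge [OF that, of u]]]
    by auto

  \<comment> \<open>The test vector \<open>F u * y\<close> transported back to the cover.\<close>
  define z where "z = (\<lambda>F. \<chi> x. case inv (\<lambda>(u, v). \<phi> u v) x of (u, v) \<Rightarrow> complex_of_real (F u) * y $ v)"
  have z: "to_blocks \<phi> (z F) = (\<chi> u. of_real (F u) *s y)" for F
    using inv_f_f [OF bij_is_inj [OF \<phi>], of "(u, v)" for u v]
    by (simp add: to_blocks_def z_def vec_eq_iff)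
  have zz: "cinner (z F) (z G) = of_real (\<Sum>u\<in>UNIV. F u * G u)" for F G
  proof -
    have "cinner y y = 1"
      using y cnj_cinner [of y y] by (simp add: complex_eq_iff dot_square_norm flip: inner_eq_Re_cinner)
    then show ?thesis
      by (simp add: cinner_to_blocks [OF \<phi>] z cinner_scale_left cinner_scale_right mult.commute)
  qed
  have Jz: "cinner (J *v z F) (z G) = of_real (\<Sum>u\<in>UNIV. F u * G u) * cinner (B *v y) y +
      (\<Sum>i = 1..l. of_real (\<Sum>u\<in>UNIV. F (\<sigma> i u) * G u) * cinner (A i *v y) y +
         of_real (\<Sum>u\<in>UNIV. F u * G (\<sigma> i u)) * cnj (cinner (A i *v y) y))" for F G
  proof -
    have "to_blocks \<phi> (J *v z F) = block_operator l B A \<sigma> (to_blocks \<phi> (z F))"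
      using lift_eq_block_operator [OF inj dir skel, of a b "z F"]
      by (simp only: J B ext [of A, OF A])
    then show ?thesis
      by (simp only: cinner_to_blocks [OF \<phi>] z vec_lambda_beta cinner_block_operator [OF bij])
  qed
  have nrm: "(norm x)\<^sup>2 = Re (cinner x x)" for x :: "complex^'x"
    by (simp add: power2_norm_eq_inner inner_eq_Re_cinner)
  have rayleigh: "z F \<noteq> 0 \<and> Re (cinner (J *v z F) (z F)) \<ge> \<mu> * (norm (z F))\<^sup>2"
    if F: "(\<Sum>u\<in>UNIV. (F u)\<^sup>2) = 2 * real r"
      "(\<Sum>i = 1..l. \<alpha> i * (\<Sum>u\<in>UNIV. F u * F (\<sigma> i u))) \<ge> 2 * real r * sqrt (real d - 1) * m - C" for F
  proof -
    have n: "(norm (z F))\<^sup>2 = 2 * real r"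
      using F(1) unfolding nrm zz by (simp add: power2_eq_square)
    have "Re (cinner (J *v z F) (z F)) = 2 * real r * \<beta> + 2 * (\<Sum>i = 1..l. \<alpha> i * (\<Sum>u\<in>UNIV. F u * F (\<sigma> i u)))"
      using F(1) unfolding Jz by (simp add: \<alpha>_def \<beta>_def power2_eq_square sum_distrib_left mult_ac)
    also have "\<dots> \<ge> 2 * real r * \<beta> + 2 * (2 * real r * sqrt (real d - 1) * m - C)"
      using F(2) by simp
    \<comment> \<open>The edge bound enters twice, for \<open>A i\<close> and its adjoint, and the
      squared norm is \<open>2 * r\<close>; so the loss \<open>2 * C\<close> becomes
      \<open>C / r\<close>.\<close>
    also have "2 * real r * \<beta> + 2 * (2 * real r * sqrt (real d - 1) * m - C) = \<mu> * (norm (z F))\<^sup>2"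
      using r by (simp add: n \<mu>_def field_simps)
    finally show ?thesis using n r by auto
  qed
  have "\<mu> \<le> eigval 2 J"
  \<comment> \<open>Disjoint supports give orthogonality, and non-adjacent supports make the cross
    term of \<open>J\<close> vanish.\<close>
  proof (rule eigval_2_ge)
    show "ctranspose J = J" unfolding J by (rule ctranspose_jacobi_on)
    show "cinner (z F\<^sub>1) (z F\<^sub>2) = 0" by (simp add: zz disj)
    show "cinner (J *v z F\<^sub>1) (z F\<^sub>2) = 0" by (simp add: Jz disj sep)
  qed (use rayleigh [OF F\<^sub>1(1,2)] rayleigh [OF F\<^sub>2(1,2)] in auto)
  then show ?thesis by (simp add: \<mu>_def \<beta>_def mean)
qed

end
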